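(* An integral domain $R$ is a dp-minimal Noetherian domain if and only if it is one of the following: (1) a dp-minimal field; (2) an equicharacteristic dp-minimal DVR; (3) a finite-index subring of a mixed characteristic dp-minimal DVR.
   Context: Rings are commutative and unital; a ring is dp-minimal if the structure $(R,+,\cdot)$ in the language of rings has dp-rank $1$. A DVR is a discrete valuation ring. A dp-minimal DVR has fraction field of characteristic $0$, and its residue field is either a (dp-minimal) field of characteristic $0$ or a finite field; an equicharacteristic dp-minimal DVR is a dp-minimal DVR whose residue field has characteristic $0$, and a mixed characteristic dp-minimal DVR is a dp-minimal DVR whose residue field is finite. A finite-index subring of a ring $A$ is a subring $S\subseteq A$ such that $S$ has finite index in the additive group $(A,+)$. *)

theory Defs
  imports "HOL-Algebra.Algebra"
begin

datatype rterm = Var nat | Add rterm rterm | Mul rterm rterm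

datatype rform = Eq rterm rterm | Neg rform | Conj rform rform | Ex nat rform

fun tm_eval :: "('a, 'b) ring_scheme \<Rightarrow> (nat \<Rightarrow> 'a) \<Rightarrow> rterm \<Rightarrow> 'a" where
  "tm_eval R e (Var n) = e n"
| "tm_eval R e (Add s t) = tm_eval R e s \<oplus>\<^bsub>R\<^esub> tm_eval R e t"
| "tm_eval R e (Mul s t) = tm_eval R e s \<otimes>\<^bsub>R\<^esub> tm_eval R e t"

fun sat :: "('a, 'b) ring_scheme \<Rightarrow> (nat \<Rightarrow> 'a) \<Rightarrow> rform \<Rightarrow> bool" where
  "sat R e (Eq s t) = (tm_eval R e s = tm_eval R e t)"
| "sat R e (Neg f) = (\<not> sat R e f)"
| "sat R e (Conj f g) = (sat R e f \<and> sat R e g)"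
| "sat R e (Ex n f) = (\<exists>a\<in>carrier R. sat R (e(n := a)) f)"

text \<open>A formula phi is read as phi(x; y) where x is variable 0 and the parameter
  tuple y consists of all other variables; a parameter is an environment into the carrier.
  ict2_finite R phi psi n: an ICT pattern of depth 2 with n rows/columns exists in R.\<close>
definition ict2_finite :: "('a, 'b) ring_scheme \<Rightarrow> rform \<Rightarrow> rform \<Rightarrow> nat \<Rightarrow> bool" where
  "ict2_finite R \<phi> \<psi> n \<longleftrightarrow>
     (\<exists>(b :: nat \<Rightarrow> nat \<Rightarrow> 'a) (c :: nat \<Rightarrow> nat \<Rightarrow> 'a) (a :: nat \<Rightarrow> nat \<Rightarrow> 'a).
        (\<forall>k<n. range (b k) \<subseteq> carrier R \<and> range (c k) \<subseteq> carrier R) \<and>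
        (\<forall>i<n. \<forall>j<n. a i j \<in> carrier R \<and>
           (\<forall>k<n. (sat R ((b k)(0 := a i j)) \<phi> \<longleftrightarrow> k = i) \<and>
                  (sat R ((c k)(0 := a i j)) \<psi> \<longleftrightarrow> k = j))))"

text \<open>dp-rank exactly 1: the structure is infinite (dp-rank at least 1) and there is no
  ICT pattern of depth 2 in an elementary extension; by compactness the latter means that
  there are no formulas admitting finite depth-2 ICT patterns of every size in R itself.\<close>
definition dp_minimal :: "('a, 'b) ring_scheme \<Rightarrow> bool" where
  "dp_minimal R \<longleftrightarrow> infinite (carrier R) \<and> \<not> (\<exists>\<phi> \<psi>. \<forall>n. ict2_finite R \<phi> \<psi> n)"

definition DVR :: "('a, 'b) ring_scheme \<Rightarrow> bool" where
  "DVR A \<longleftrightarrow> principal_domain A \<and> \<not> field A \<and> (\<exists>!m. maximalideal m A)"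

definition residue_field :: "('a, 'b) ring_scheme \<Rightarrow> 'a set ring" where
  "residue_field A = A Quot (THE m. maximalideal m A)"

definition char_zero_ring :: "('a, 'b) ring_scheme \<Rightarrow> bool" where
  "char_zero_ring R \<longleftrightarrow> (\<forall>n::nat. n > 0 \<longrightarrow> [n] \<cdot>\<^bsub>R\<^esub> \<one>\<^bsub>R\<^esub> \<noteq> \<zero>\<^bsub>R\<^esub>)"

definition equichar_dp_minimal_DVR :: "('a, 'b) ring_scheme \<Rightarrow> bool" where
  "equichar_dp_minimal_DVR A \<longleftrightarrow> DVR A \<and> dp_minimal A \<and> char_zero_ring (residue_field A)"

definition mixedchar_dp_minimal_DVR :: "('a, 'b) ring_scheme \<Rightarrow> bool" where
  "mixedchar_dp_minimal_DVR A \<longleftrightarrow> DVR A \<and> dp_minimal A \<and> finite (carrier (residue_field A))"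

definition finite_index_subring :: "'a set \<Rightarrow> ('a, 'b) ring_scheme \<Rightarrow> bool" where
  "finite_index_subring S A \<longleftrightarrow> subring S A \<and> finite (a_rcosets\<^bsub>A\<^esub> S)"

end

theory Submission
  imports Defs
begin

text \<open>
  Dp-minimality enters through cosets of two principal ideals: if \<open>r\<^sub>i a\<close> are pairwise incongruent
  modulo \<open>b\<close> and \<open>s\<^sub>i b\<close> pairwise incongruent modulo \<open>a\<close>, the elements \<open>r\<^sub>i a + s\<^sub>j b\<close> form a
  pattern of depth 2, so one of the two families has bounded length. Applied to powers of \<open>a\<close> and \<open>b\<close> with
  \<open>a + b = 1\<close> this shows that \<open>R\<close> is local. Let \<open>R\<close> be Noetherian and not a field.
  If the residue field is infinite, \<open>R\<close> is a valuation ring,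
  hence a DVR, and its residue characteristic is 0 because for residue characteristic \<open>p\<close> the elements
  \<open>x\<^sup>p + t y\<^sup>p\<close>, where \<open>t\<close> is a uniformizer, would yield a pattern of depth 2 modulo \<open>t\<^sup>2\<close>. If the
  residue field is finite, there is \<open>c \<noteq> 0\<close> such that \<open>b\<close> divides \<open>c a\<close> or \<open>a\<close> divides \<open>c b\<close> for all
  \<open>a\<close>, \<open>b\<close>. Then the complete integral closure of \<open>R\<close> is a DVR contained in \<open>c\<^sup>-\<^sup>2 R\<close> in which \<open>R\<close>
  has finite index, and it is interpretable in \<open>R\<close>. Conversely, a finite-index subring of a DVR with
  finite residue field contains a nonzero ideal of the DVR, which has finite index; it is therefore
  interpretable in the DVR, and its ideals are finitely generated.
\<close>

subsection \<open>Interpretations\<close>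

lemma not_dp_minimalI: "(\<And>n. ict2_finite R \<phi> \<psi> n) \<Longrightarrow> \<not> dp_minimal R"
  unfolding dp_minimal_def by blast

text \<open>Variable 0 is the distinguished variable of a pattern and stays in place. The others
  move past the slots reserved for the bound variable and the parameters, so that nothing is
  captured.\<close>

definition shift_var :: "nat \<Rightarrow> nat \<Rightarrow> nat" where
  "shift_var q n = (if n = 0 then 0 else n + q + 4)"

text \<open>The language has no division. Since \<open>g x\<close> times \<open>g y\<close> is
  \<open>d\<close> times the image of the product, each product computed in \<open>C\<close> carries
  an extra factor \<open>d\<close>; \<open>den\<close> counts these factors, and summands are first
  brought to a common power of \<open>d\<close>.\<close>

fun lift_tm :: "nat \<Rightarrow> rterm \<Rightarrow> rterm" and den :: "rterm \<Rightarrow> nat" where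
  "lift_tm q (Var n) = Var (shift_var q n)"
| "lift_tm q (Add s t) =
     Add ((Mul (Var 2) ^^ den t) (lift_tm q s)) ((Mul (Var 2) ^^ den s) (lift_tm q t))"
| "lift_tm q (Mul s t) = Mul (lift_tm q s) (lift_tm q t)"
| "den (Var n) = 0"
| "den (Add s t) = den s + den t"
| "den (Mul s t) = Suc (den s + den t)"

text \<open>Defines the image of the interpretation inside \<open>C\<close>, as a disjunction over
  \<open>q\<close> cosets written with negation and conjunction; the empty union is an unsatisfiable
  formula.\<close>

fun coset_union :: "nat \<Rightarrow> nat \<Rightarrow> rform" where
  "coset_union n 0 = Neg (Eq (Var n) (Var n))"
| "coset_union n (Suc q) = Neg (Conj (Neg (coset_union n q))
     (Neg (Ex 1 (Eq (Var n) (Add (Mul (Var 3) (Var 1)) (Var (4 + q)))))))"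

text \<open>Equations are compared at a common power of \<open>d\<close>, and quantifiers are
  relativised to the image of the interpreted structure.\<close>

fun lift_form :: "nat \<Rightarrow> rform \<Rightarrow> rform" where
  "lift_form q (Eq s t) =
     Eq ((Mul (Var 2) ^^ den t) (lift_tm q s)) ((Mul (Var 2) ^^ den s) (lift_tm q t))"
| "lift_form q (Neg f) = Neg (lift_form q f)"
| "lift_form q (Conj f g) = Conj (lift_form q f) (lift_form q g)"
| "lift_form q (Ex n f) = Ex (shift_var q n) (Conj (coset_union (shift_var q n) q) (lift_form q f))"

lemma tm_eval_closed:
  assumes "ring R" "range e \<subseteq> carrier R"
  shows "tm_eval R e t \<in> carrier R"
proof -
  interpret ring R by fact
  show ?thesis using assms(2) by (induction t) auto
qed

lemma tm_eval_Mul_pow: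
  assumes "ring R" "e v \<in> carrier R" "tm_eval R e t \<in> carrier R"
  shows "tm_eval R e ((Mul (Var v) ^^ k) t) = e v [^]\<^bsub>R\<^esub> k \<otimes>\<^bsub>R\<^esub> tm_eval R e t"
proof -
  interpret ring R by fact
  show ?thesis using assms(2,3)
    by (induction k) (auto simp: m_assoc[symmetric] nat_pow_Suc2[symmetric] simp del: nat_pow_Suc)
qed

lemma sat_coset_union:
  assumes "n \<noteq> 1"
  shows "sat R e (coset_union n q) \<longleftrightarrow>
    (\<exists>i<q. \<exists>y\<in>carrier R. e n = e 3 \<otimes>\<^bsub>R\<^esub> y \<oplus>\<^bsub>R\<^esub> e (4 + i))"
  using assms by (induction q) (auto simp: less_Suc_eq)

lemma (in "domain") nat_pow_nonzero:
  "x \<in> carrier R \<Longrightarrow> x \<noteq> \<zero> \<Longrightarrow> x [^] (n::nat) \<noteq> \<zero>"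
  by (induction n) (auto simp: integral_iff)

text \<open>A structure sitting inside \<open>C\<close> as a finite union of cosets of a principal ideal, with the
  multiplication of \<open>C\<close> divided by \<open>d\<close>, is interpretable in \<open>C\<close>. Variable \<open>0\<close> keeps its role, the
  variables 2, 3, 4, ... of the translated formulas hold the parameters \<open>d\<close>, \<open>u\<close>, \<open>s 0\<close>, ..., and
  variable 1 is bound.\<close>

locale coset_interpretation = B: ring B + C: "domain" C
  for B :: "('b, 'm) ring_scheme" and C :: "('a, 'n) ring_scheme" +
  fixes g :: "'b \<Rightarrow> 'a" and d u :: 'a and s :: "nat \<Rightarrow> 'a" and q :: nat
  assumes inj: "inj_on g (carrier B)"
    and d: "d \<in> carrier C" "d \<noteq> \<zero>\<^bsub>C\<^esub>"
    and u: "u \<in> carrier C" and s: "\<And>i. i < q \<Longrightarrow> s i \<in> carrier C"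
    and g_add: "\<And>x y. x \<in> carrier B \<Longrightarrow> y \<in> carrier B \<Longrightarrow> g (x \<oplus>\<^bsub>B\<^esub> y) = g x \<oplus>\<^bsub>C\<^esub> g y"
    and g_mult: "\<And>x y. x \<in> carrier B \<Longrightarrow> y \<in> carrier B \<Longrightarrow>
                   d \<otimes>\<^bsub>C\<^esub> g (x \<otimes>\<^bsub>B\<^esub> y) = g x \<otimes>\<^bsub>C\<^esub> g y"
    and image: "g ` carrier B = {x. \<exists>i<q. \<exists>y\<in>carrier C. x = u \<otimes>\<^bsub>C\<^esub> y \<oplus>\<^bsub>C\<^esub> s i}"
begin

definition agree :: "(nat \<Rightarrow> 'b) \<Rightarrow> (nat \<Rightarrow> 'a) \<Rightarrow> bool" where
  "agree e e' \<longleftrightarrow> range e \<subseteq> carrier B \<and> (\<forall>n. e' (shift_var q n) = g (e n)) \<and>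
     e' 2 = d \<and> e' 3 = u \<and> (\<forall>i<q. e' (4 + i) = s i)"

lemma g_closed: "x \<in> carrier B \<Longrightarrow> g x \<in> carrier C"
proof -
  assume "x \<in> carrier B"
  then have "g x \<in> g ` carrier B" by blast
  then show ?thesis unfolding image using u s by auto
qed

lemma agree_closed: "agree e e' \<Longrightarrow> tm_eval B e t \<in> carrier B"
  unfolding agree_def using tm_eval_closed[OF B.ring_axioms] by blast

lemma tm_eval_lift:
  assumes "agree e e'"
  shows "tm_eval C e' (lift_tm q t) = d [^]\<^bsub>C\<^esub> den t \<otimes>\<^bsub>C\<^esub> g (tm_eval B e t)"
proof -
  note cl = agree_closed[OF assms] and e2 = assms[unfolded agree_def]
  note P = tm_eval_Mul_pow[OF C.ring_axioms]
  show ?thesis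
  proof (induction t)
    case (Var n)
    then show ?case using e2 g_closed by (auto simp: range_subsetD)
  next
    case (Add x y)
    have "g (tm_eval B e x) \<in> carrier C" "g (tm_eval B e y) \<in> carrier C" using cl g_closed by auto
    then show ?case using Add d e2 cl
      by (simp add: P g_add C.r_distr C.nat_pow_mult[symmetric] C.m_ac)
  next
    case (Mul x y)
    have 1: "g (tm_eval B e x) \<in> carrier C" "g (tm_eval B e y) \<in> carrier C"
      "g (tm_eval B e x \<otimes>\<^bsub>B\<^esub> tm_eval B e y) \<in> carrier C" using cl g_closed by auto
    have "tm_eval C e' (lift_tm q (Mul x y)) = d [^]\<^bsub>C\<^esub> den x \<otimes>\<^bsub>C\<^esub> (d [^]\<^bsub>C\<^esub> den y \<otimes>\<^bsub>C\<^esub>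
      (g (tm_eval B e x) \<otimes>\<^bsub>C\<^esub> g (tm_eval B e y)))" using 1 d Mul by (simp add: C.m_ac)
    also have "\<dots> = d [^]\<^bsub>C\<^esub> den (Mul x y) \<otimes>\<^bsub>C\<^esub> g (tm_eval B e (Mul x y))"
      using 1 d cl by (simp add: g_mult[symmetric] C.nat_pow_mult[symmetric] C.m_ac)
    finally show ?case .
  qed
qed

lemma shift_var_neq [simp]: "shift_var q n \<noteq> Suc 0" "shift_var q n \<noteq> 2" "shift_var q n \<noteq> 3"
  "i < q \<Longrightarrow> shift_var q n \<noteq> 4 + i" and shift_var_inj [simp]: "shift_var q n = shift_var q m \<longleftrightarrow> n = m"
  unfolding shift_var_def by auto

lemma agree_upd:
  assumes "agree e e'" "a \<in> carrier B"
  shows "agree (e(n := a)) (e'(shift_var q n := g a))"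
proof -
  have "\<forall>i<q. 4 + i \<noteq> shift_var q n" using shift_var_neq(4)[of _ n] by fastforce
  moreover have "2 \<noteq> shift_var q n" "3 \<noteq> shift_var q n" using shift_var_neq(2,3)[of n] by presburger+
  ultimately show ?thesis using assms unfolding agree_def by auto
qed

text \<open>For equations both sides are images multiplied by the same nonzero power of
  \<open>d\<close>, which cancels in the domain \<open>C\<close>; injectivity of \<open>g\<close>
  does the rest. For quantifiers the relativising formula cuts out exactly the image of
  \<open>g\<close>.\<close>

lemma sat_lift: "agree e e' \<Longrightarrow> sat C e' (lift_form q f) \<longleftrightarrow> sat B e f"
proof (induction f arbitrary: e e')
  case (Eq x y)
  let ?x = "tm_eval B e x" and ?y = "tm_eval B e y"
  have 1: "?x \<in> carrier B" "?y \<in> carrier B" "g ?x \<in> carrier C" "g ?y \<in> carrier C" "e' 2 = d"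
    using agree_closed[OF Eq] g_closed Eq by (auto simp: agree_def)
  let ?D = "d [^]\<^bsub>C\<^esub> den x \<otimes>\<^bsub>C\<^esub> d [^]\<^bsub>C\<^esub> den y"
  have D: "?D \<in> carrier C" "?D \<noteq> \<zero>\<^bsub>C\<^esub>" using d by (auto simp: C.integral_iff C.nat_pow_nonzero)
  have "sat C e' (lift_form q (Eq x y)) \<longleftrightarrow> ?D \<otimes>\<^bsub>C\<^esub> g ?x = ?D \<otimes>\<^bsub>C\<^esub> g ?y"
    using 1 d by (simp add: tm_eval_Mul_pow[OF C.ring_axioms] tm_eval_lift[OF Eq] C.m_ac)
  also have "\<dots> \<longleftrightarrow> g ?x = g ?y" using 1 D C.m_lcancel by blast
  also have "\<dots> \<longleftrightarrow> ?x = ?y" using 1 inj by (auto dest: inj_onD)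
  finally show ?case by simp
next
  case (Ex n f)
  have A: "sat C (e'(shift_var q n := z)) (coset_union (shift_var q n) q) \<longleftrightarrow> z \<in> g ` carrier B" for z
  proof -
    let ?e = "e'(shift_var q n := z)"
    have "\<forall>i<q. 4 + i \<noteq> shift_var q n" using shift_var_neq(4)[of _ n] by fastforce
    then have 4: "\<forall>i<q. ?e (4 + i) = s i" using Ex.prems by (simp add: agree_def)
    have "3 \<noteq> shift_var q n" using shift_var_neq(3)[of n] by presburger
    then have 3: "?e 3 = u" using Ex.prems by (simp add: agree_def)
    have "sat C ?e (coset_union (shift_var q n) q) \<longleftrightarrow>
        (\<exists>i<q. \<exists>y\<in>carrier C. z = u \<otimes>\<^bsub>C\<^esub> y \<oplus>\<^bsub>C\<^esub> ?e (4 + i))"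
      using sat_coset_union[of "shift_var q n" C ?e q] 3 by simp
    then show ?thesis unfolding image mem_Collect_eq using 4 by metis
  qed
  have "sat C e' (lift_form q (Ex n f)) \<longleftrightarrow>
      (\<exists>a\<in>carrier B. sat C (e'(shift_var q n := g a)) (lift_form q f))"
    using A g_closed by auto
  also have "\<dots> \<longleftrightarrow> (\<exists>a\<in>carrier B. sat B (e(n := a)) f)"
    using Ex.IH[OF agree_upd[OF Ex.prems]] by blast
  finally show ?case by simp
qed auto

text \<open>Variables 1 and \<open>q + 4\<close> hold no data; the default zero keeps the whole
  environment in the carrier, as patterns demand.\<close>

definition lift_env :: "(nat \<Rightarrow> 'b) \<Rightarrow> nat \<Rightarrow> 'a" where
  "lift_env e v = (if v = 0 then g (e 0) else if q + 4 < v then g (e (v - (q + 4)))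
     else if v = 2 then d else if v = 3 then u else if 4 \<le> v \<and> v < 4 + q then s (v - 4) else \<zero>\<^bsub>C\<^esub>)"

lemma lift_env:
  assumes "range e \<subseteq> carrier B"
  shows "agree e (lift_env e)" "range (lift_env e) \<subseteq> carrier C"
  using assms d u s g_closed by (auto simp: agree_def lift_env_def shift_var_def range_subsetD)

text \<open>The pattern is carried over by \<open>g\<close>. The translated formulas do not depend
  on its size, so patterns of all sizes transfer together.\<close>

lemma ict2_finite_lift:
  assumes "ict2_finite B \<phi> \<psi> n"
  shows "ict2_finite C (lift_form q \<phi>) (lift_form q \<psi>) n"
proof -
  from assms obtain b c a where bc: "\<forall>k<n. range (b k) \<subseteq> carrier B \<and> range (c k) \<subseteq> carrier B"
    and p: "\<forall>i<n. \<forall>j<n. a i j \<in> carrier B \<and>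
      (\<forall>k<n. (sat B ((b k)(0 := a i j)) \<phi> \<longleftrightarrow> k = i) \<and> (sat B ((c k)(0 := a i j)) \<psi> \<longleftrightarrow> k = j))"
    unfolding ict2_finite_def by (elim exE conjE)
  have eq: "sat C ((lift_env e)(0 := g x)) (lift_form q f) \<longleftrightarrow> sat B (e(0 := x)) f"
    if "range e \<subseteq> carrier B" "x \<in> carrier B" for e x f
    using sat_lift[OF agree_upd[OF lift_env(1)[OF that(1)] that(2), of 0]] by (simp add: shift_var_def)
  show ?thesis unfolding ict2_finite_def
    apply (rule exI[of _ "\<lambda>k. lift_env (b k)"], rule exI[of _ "\<lambda>k. lift_env (c k)"],
        rule exI[of _ "\<lambda>i j. g (a i j)"])
    using lift_env(2) bc p g_closed by (simp add: eq)
qed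

lemma dp_minimal_lift:
  assumes "dp_minimal C" "infinite (carrier B)"
  shows "dp_minimal B"
  using assms ict2_finite_lift unfolding dp_minimal_def by blast

end

subsection \<open>Noetherian rings and ideals of finite index\<close>

text \<open>By the ascending chain condition the union of a nonempty chain of ideals already belongs
  to the chain, so Zorn's lemma applies to any nonempty family of ideals.\<close>

lemma (in noetherian_ring) obtains_maximal_member:
  assumes "S \<noteq> {}" "\<And>I. I \<in> S \<Longrightarrow> ideal I R"
  obtains M where "M \<in> S" "\<And>I. I \<in> S \<Longrightarrow> M \<subseteq> I \<Longrightarrow> I = M"
proof -
  have "\<exists>M\<in>S. \<forall>I\<in>S. M \<subseteq> I \<longrightarrow> I = M"
  proof (rule subset_Zorn_nonempty[OF assms(1)])
    fix C assume C: "C \<noteq> {}" "subset.chain S C"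
    have sub: "C \<subseteq> S" using C(2) by (simp add: subset_chain_def)
    then have "C \<subseteq> {I. ideal I R}" using assms(2) by blast
    then have "subset.chain {I. ideal I R} C" using C(2) by (simp add: subset_chain_def)
    then have "\<Union>C \<in> C" by (rule ideal_chain_is_trivial[OF C(1)])
    then show "\<Union>C \<in> S" using sub by (rule subsetD[rotated])
  qed
  then show ?thesis using that by blast
qed

section \<open>Divisibility in commutative rings\<close>

lemma (in cring) divides_closed_ideal:
  assumes "ideal I R" "x \<in> I" "x divides y"
  shows "y \<in> I"
  using assms(3) ideal.I_r_closed[OF assms(1,2)] by (auto)

lemma (in cring) divides_add:
  assumes "a \<in> carrier R" "a divides x" "a divides y"
  shows "a divides (x \<oplus> y)"
  using assms by (metis (no_types, lifting) factor_def add.m_closed r_distr)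

lemma (in cring) divides_mult:
  assumes "a \<in> carrier R" "a divides x" "x \<in> carrier R" "y \<in> carrier R"
  shows "a divides (x \<otimes> y)" "a divides (y \<otimes> x)"
  using assms by (metis divides_prod_r, metis m_comm divides_prod_r)

lemma (in cring) divides_a_inv:
  assumes "a \<in> carrier R" "a divides x"
  shows "a divides (\<ominus> x)"
  using assms by (metis (no_types, lifting) factor_def a_inv_closed r_minus)

lemma (in cring) divides_minus:
  assumes "a \<in> carrier R" "a divides x" "a divides y"
  shows "a divides (x \<ominus> y)"
  unfolding minus_eq by (rule divides_add[OF assms(1,2) divides_a_inv[OF assms(1,3)]])

text \<open>The set is the colon ideal \<open>(a) : y\<close>.\<close>

lemma (in cring) divides_ideal:
  assumes "a \<in> carrier R" "y \<in> carrier R"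
  shows "ideal {x \<in> carrier R. a divides y \<otimes> x} R"
proof (rule idealI[OF ring_axioms])
  show "subgroup {x \<in> carrier R. a divides y \<otimes> x} (add_monoid R)"
  proof (intro add.subgroupI)
    show "{x \<in> carrier R. a divides y \<otimes> x} \<noteq> {}" using assms by (auto intro!: exI[of _ \<zero>] dividesI[of \<zero>])
  qed (use assms in \<open>auto intro: divides_add divides_a_inv simp: r_distr r_minus simp flip: a_inv_def\<close>)
  fix x b assume "x \<in> {x \<in> carrier R. a divides y \<otimes> x}" and b: "b \<in> carrier R"
  then show "b \<otimes> x \<in> {x \<in> carrier R. a divides y \<otimes> x}"
    using divides_mult(2)[OF assms(1), of "y \<otimes> x" b] assms b m_lcomm[of b y x] by simp
  then show "x \<otimes> b \<in> {x \<in> carrier R. a divides y \<otimes> x}"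
    using m_comm \<open>x \<in> _\<close> b by simp
qed

text \<open>The colon ideals \<open>(e) : y^n\<close> ascend and so become stationary. If all powers
  divided \<open>e\<close>, writing \<open>e = y^(n+1) z\<close> at a stationary stage would put
  \<open>z\<close> into \<open>(e) : y^n\<close>, so \<open>y^n z = e t = y^n z y t\<close>;
  cancelling gives \<open>y t = 1\<close>.\<close>

lemma (in noetherian_domain) nonunit_powers_not_dividing:
  assumes y: "y \<in> carrier R" "y \<notin> Units R" and e: "e \<in> carrier R" "e \<noteq> \<zero>"
  shows "\<exists>n::nat. \<not> y [^] n divides e"
proof (rule ccontr)
  assume "\<not> ?thesis"
  then have all: "y [^] (n::nat) divides e" for n by blast
  define J where "J n = {x \<in> carrier R. e divides y [^] (n::nat) \<otimes> x}" for n
  have J: "ideal (J n) R" for n unfolding J_def using divides_ideal y e by simp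
  obtain M where M: "M \<in> range J" "\<And>I. I \<in> range J \<Longrightarrow> M \<subseteq> I \<Longrightarrow> I = M"
    using obtains_maximal_member[of "range J"] J by blast
  then obtain n where n: "M = J n" by blast
  have "J n \<subseteq> J (Suc n)"
  proof
    fix x assume "x \<in> J n"
    then have x: "x \<in> carrier R" "e divides y [^] n \<otimes> x" unfolding J_def by auto
    then have "e divides y \<otimes> (y [^] n \<otimes> x)" using e y by (simp add: divides_mult)
    then show "x \<in> J (Suc n)" using x y unfolding J_def by (simp add: m_ac)
  qed
  then have eq: "J (Suc n) = J n" using M n by blast
  from all[of "Suc n"] obtain z where z: "z \<in> carrier R" "e = y [^] Suc n \<otimes> z"
    by (auto)
  then have "z \<in> J (Suc n)" unfolding J_def using e by auto
  then have "e divides y [^] n \<otimes> z" using eq unfolding J_def by blast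
  then obtain t where t: "t \<in> carrier R" "y [^] n \<otimes> z = e \<otimes> t" by (auto)
  have nz: "y [^] n \<otimes> z \<noteq> \<zero>" using z y e by (auto simp: m_ac integral_iff)
  have "(y [^] n \<otimes> z) \<otimes> (y \<otimes> t) = (y [^] n \<otimes> z) \<otimes> \<one>"
    using t z y by (simp add: m_ac)
  then have "y \<otimes> t = \<one>" using m_lcancel[OF nz, of "y \<otimes> t" \<one>] z(1) y t(1) by blast
  then show False using y t m_comm unfolding Units_def by auto
qed

text \<open>Stated with representatives instead of cosets, because the proofs build a finite set of
  representatives for one ideal out of those for others.\<close>

definition (in ring) finite_index :: "'a set \<Rightarrow> bool" where
  "finite_index I \<longleftrightarrow> (\<exists>F. finite F \<and> F \<subseteq> carrier R \<and> (\<forall>x\<in>carrier R. \<exists>f\<in>F. x \<ominus> f \<in> I))"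

lemma (in ring) rcos_eq_iff:
  assumes "additive_subgroup I R" "x \<in> carrier R" "y \<in> carrier R"
  shows "I +> x = I +> y \<longleftrightarrow> x \<ominus> y \<in> I"
proof -
  interpret additive_subgroup I R by fact
  interpret abelian_subgroup I R using a_subgroup by (intro abelian_subgroupI3) (unfold_locales)
  show ?thesis using assms(2,3) a_rcos_module_minus[OF ring_axioms]
    by (metis a_repr_independence' a_rcos_self)
qed

lemma (in ring) finite_index_iff:
  assumes "additive_subgroup I R"
  shows "finite_index I \<longleftrightarrow> finite (a_rcosets I)"
proof
  assume "finite_index I"
  then obtain F where F: "finite F" "F \<subseteq> carrier R" "\<forall>x\<in>carrier R. \<exists>f\<in>F. x \<ominus> f \<in> I"
    unfolding finite_index_def by blast
  have "a_rcosets I \<subseteq> (+>) I ` F"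
  proof
    fix D assume "D \<in> a_rcosets I"
    then obtain x where x: "x \<in> carrier R" "D = I +> x" by (auto simp: A_RCOSETS_def')
    then obtain f where "f \<in> F" "x \<ominus> f \<in> I" using F(3) by blast
    then show "D \<in> (+>) I ` F" using x F(2) rcos_eq_iff[OF assms, of x f] by blast
  qed
  then show "finite (a_rcosets I)" using F(1) finite_subset by blast
next
  assume "finite (a_rcosets I)"
  moreover have "a_rcosets I = (+>) I ` carrier R" by (auto simp: A_RCOSETS_def')
  ultimately obtain F where F: "F \<subseteq> carrier R" "finite F" "(+>) I ` carrier R = (+>) I ` F"
    by (metis finite_subset_image order_refl)
  have "\<exists>f\<in>F. x \<ominus> f \<in> I" if x: "x \<in> carrier R" for x
  proof -
    have "I +> x \<in> (+>) I ` F" using x F(3) by blast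
    then obtain f where "f \<in> F" "I +> x = I +> f" by blast
    then show ?thesis using rcos_eq_iff[OF assms x, of f] F(1) by blast
  qed
  then show "finite_index I" unfolding finite_index_def using F by blast
qed

lemma (in ring) infinite_index_sequence:
  assumes "additive_subgroup I R" "\<not> finite_index I"
  obtains r :: "nat \<Rightarrow> 'a" where "range r \<subseteq> carrier R" "\<And>i j. i \<noteq> j \<Longrightarrow> r i \<ominus> r j \<notin> I"
proof -
  obtain c :: "nat \<Rightarrow> 'a set" where c: "inj c" "range c \<subseteq> a_rcosets I"
    using assms finite_index_iff infinite_countable_subset by metis
  then have "\<forall>i. \<exists>x. x \<in> carrier R \<and> c i = I +> x" unfolding A_RCOSETS_def' by blast
  then obtain r where r: "\<And>i. r i \<in> carrier R" "\<And>i. c i = I +> r i" by metis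
  have "r i \<ominus> r j \<notin> I" if "i \<noteq> j" for i j
    using that c(1) rcos_eq_iff[OF assms(1), of "r i" "r j"] r unfolding inj_def by metis
  then show ?thesis using that r by blast
qed

text \<open>Noetherian induction: a nonzero ideal \<open>M\<close> maximal among those of infinite
  index is not prime, so it contains \<open>a b\<close> for some \<open>a\<close>, \<open>b\<close>
  outside. Then \<open>M : a\<close> and \<open>M + (a)\<close> are strictly larger, hence of finite
  index, and together they force finite index of \<open>M\<close>.\<close>

lemma (in noetherian_domain) finite_index_nonzero_ideal:
  assumes prime: "\<And>P. primeideal P R \<Longrightarrow> P \<noteq> {\<zero>} \<Longrightarrow> finite_index P"
    and I: "ideal I R" "I \<noteq> {\<zero>}"
  shows "finite_index I"
proof (rule ccontr)
  assume "\<not> finite_index I"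
  define S where "S = {J. ideal J R \<and> J \<noteq> {\<zero>} \<and> \<not> finite_index J}"
  obtain M where M: "M \<in> S" "\<And>J. J \<in> S \<Longrightarrow> M \<subseteq> J \<Longrightarrow> J = M"
  proof (rule obtains_maximal_member[of S])
    show "S \<noteq> {}" using I \<open>\<not> finite_index I\<close> unfolding S_def by auto
  qed (auto simp: S_def)
  interpret M: ideal M R using M(1) by (simp add: S_def)
  have M0: "M \<noteq> {\<zero>}" "\<not> finite_index M" using M(1) by (simp_all add: S_def)
  have "\<not> primeideal M R" using M0 prime by blast
  moreover have "carrier R \<noteq> M"
  proof
    assume "carrier R = M"
    then have "\<forall>x\<in>carrier R. \<exists>f\<in>{\<zero>}. x \<ominus> f \<in> M" by blast
    moreover have "finite {\<zero>}" "{\<zero>} \<subseteq> carrier R" by auto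
    ultimately show False using M0(2) unfolding finite_index_def by blast
  qed
  ultimately obtain a b where ab: "a \<in> carrier R" "b \<in> carrier R" "a \<otimes> b \<in> M" "a \<notin> M" "b \<notin> M"
    using M.primeidealCE[OF is_cring] by metis
  have bigger: "finite_index J" if "ideal J R" "M \<subseteq> J" "x \<in> J" "x \<notin> M" for J x
  proof (rule ccontr)
    assume "\<not> finite_index J"
    moreover have "J \<noteq> {\<zero>}" using that M.zero_closed by blast
    ultimately have "J \<in> S" using that(1) by (simp add: S_def)
    then show False using M(2) that by blast
  qed
  let ?J = "{x \<in> carrier R. a \<otimes> x \<in> M}"
  have "ideal ?J R"
  proof (rule idealI[OF ring_axioms])
    show "subgroup ?J (add_monoid R)"
    proof (intro add.subgroupI)
      show "?J \<noteq> {}" using ab(1) M.zero_closed by (auto intro!: exI[of _ \<zero>])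
    qed (use ab(1) M.a_closed M.a_inv_closed in \<open>auto simp: r_distr r_minus simp flip: a_inv_def\<close>)
    show "b \<otimes> x \<in> ?J" "x \<otimes> b \<in> ?J" if "x \<in> ?J" "b \<in> carrier R" for x b
    proof -
      have x: "x \<in> carrier R" "a \<otimes> x \<in> M" using that by auto
      then have "b \<otimes> (a \<otimes> x) \<in> M" using M.I_l_closed that(2) by blast
      then show "b \<otimes> x \<in> ?J" "x \<otimes> b \<in> ?J" using x that(2) ab(1) by (auto simp: m_ac)
    qed
  qed
  moreover have "M \<subseteq> ?J" using ab(1) M.I_l_closed M.Icarr by blast
  ultimately have "finite_index ?J" using bigger[of ?J b] ab by blast
  then obtain F where F: "finite F" "F \<subseteq> carrier R" "\<forall>x\<in>carrier R. \<exists>f\<in>F. x \<ominus> f \<in> ?J"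
    unfolding finite_index_def by blast
  let ?K = "M <+>\<^bsub>R\<^esub> PIdl a"
  have "ideal ?K R" using add_ideals M.is_ideal cgenideal_ideal ab(1) by blast
  moreover have "M \<subseteq> ?K" "a \<in> ?K"
  proof -
    interpret K: ideal "PIdl a" R using cgenideal_ideal ab(1) .
    have sum: "h \<oplus> k \<in> ?K" if "h \<in> M" "k \<in> PIdl a" for h k
      using that unfolding set_add_def' by blast
    show "a \<in> ?K"
      using sum[OF M.zero_closed cgenideal_self[OF ab(1)]] unfolding l_zero[OF ab(1)] .
    show "M \<subseteq> ?K"
    proof
      fix x assume x: "x \<in> M"
      show "x \<in> ?K" using sum[OF x K.zero_closed] unfolding r_zero[OF M.Icarr[OF x]] .
    qed
  qed
  ultimately have "finite_index ?K" using bigger[of ?K a] ab by blast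
  then obtain G where G: "finite G" "G \<subseteq> carrier R" "\<forall>x\<in>carrier R. \<exists>f\<in>G. x \<ominus> f \<in> ?K"
    unfolding finite_index_def by blast
  \<comment> \<open>An element is first reduced modulo \<open>M + (a)\<close> by some
    \<open>g\<close>; then the coefficient of \<open>a\<close> is reduced modulo
    \<open>M : a\<close> by some \<open>f\<close>.\<close>
  let ?H = "(\<lambda>(g, f). g \<oplus> a \<otimes> f) ` (G \<times> F)"
  have "\<exists>h\<in>?H. x \<ominus> h \<in> M" if x: "x \<in> carrier R" for x
  proof -
    obtain g where g: "g \<in> G" "x \<ominus> g \<in> ?K" using G x by blast
    then obtain m r where m: "m \<in> M" "r \<in> carrier R" "x \<ominus> g = m \<oplus> r \<otimes> a"
      unfolding set_add_def' cgenideal_def by blast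
    obtain f where f: "f \<in> F" "a \<otimes> (r \<ominus> f) \<in> M" using F m(2) by blast
    have c: "g \<in> carrier R" "f \<in> carrier R" "m \<in> carrier R" using g f F G m M.Icarr by auto
    have "x \<ominus> (g \<oplus> a \<otimes> f) = (x \<ominus> g) \<ominus> a \<otimes> f"
      using c x ab(1) by (simp add: minus_eq minus_add a_assoc)
    also have "\<dots> = m \<oplus> a \<otimes> (r \<ominus> f)"
      using c m(2) ab(1) unfolding m(3) by (simp add: minus_eq r_distr r_minus a_assoc m_comm)
    finally have "x \<ominus> (g \<oplus> a \<otimes> f) \<in> M" using m f M.a_closed by simp
    then show ?thesis using g(1) f(1) by (intro bexI[of _ "g \<oplus> a \<otimes> f"]) auto
  qed
  moreover have "finite ?H" using F(1) G(1) by blast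
  moreover have "?H \<subseteq> carrier R" using F(2) G(2) ab(1) by auto
  ultimately have "finite_index M" unfolding finite_index_def by blast
  then show False using M0 by blast
qed

subsection \<open>Local rings and discrete valuation rings\<close>

lemma (in ring) add_minus_cancel:
  assumes "a \<in> carrier R" "b \<in> carrier R"
  shows "(a \<oplus> b) \<ominus> a = b" "b \<oplus> (a \<ominus> b) = a" "(a \<ominus> b) \<oplus> b = a"
proof -
  have "(a \<oplus> b) \<ominus> a = \<ominus> a \<oplus> (a \<oplus> b)"
    using a_comm[of "a \<oplus> b" "\<ominus> a"] assms by (simp only: minus_eq a_closed a_inv_closed)
  then show "(a \<oplus> b) \<ominus> a = b" using r_neg1 assms by simp
  have "b \<oplus> (a \<ominus> b) = b \<oplus> (\<ominus> b \<oplus> a)"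
    using a_comm[of a "\<ominus> b"] assms by (simp only: minus_eq a_inv_closed)
  then show 1: "b \<oplus> (a \<ominus> b) = a" using r_neg2 assms by simp
  show "(a \<ominus> b) \<oplus> b = a" using a_comm[of "a \<ominus> b" b] 1 assms by (simp only: minus_closed)
qed

abbreviation (in cring) nonunits :: "'a set" where "nonunits \<equiv> carrier R - Units R"

text \<open>An elementwise form of having a single maximal ideal. It suits dp-minimality, which
  refutes a pair of nonunits with sum 1.\<close>

definition (in cring) is_local :: bool where
  "is_local \<longleftrightarrow> (\<forall>x\<in>carrier R. x \<in> Units R \<or> \<one> \<ominus> x \<in> Units R)"

lemma (in domain) zero_not_unit: "\<zero> \<notin> Units R"
proof
  assume "\<zero> \<in> Units R"
  from Units_r_inv[OF this] have "\<zero> = \<one>" using Units_inv_closed[OF \<open>\<zero> \<in> Units R\<close>] by simp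
  then show False by simp
qed

lemma (in domain) nonunits_ideal:
  assumes loc: is_local
  shows "ideal nonunits R"
proof (rule idealI[OF ring_axioms])
  have mult: "b \<otimes> x \<in> nonunits" if "x \<in> nonunits" "b \<in> carrier R" for x b
  proof -
    have "x divides b \<otimes> x" using that by (intro dividesI[of b]) (auto simp: m_comm)
    then show ?thesis using divides_unit[of x "b \<otimes> x"] that by auto
  qed
  then show "b \<otimes> x \<in> nonunits" "x \<otimes> b \<in> nonunits" if "x \<in> nonunits" "b \<in> carrier R" for x b
    using that m_comm[of x b] by auto
  show "subgroup nonunits (add_monoid R)"
  proof (intro add.subgroupI)
    show "nonunits \<noteq> {}" using zero_not_unit by blast
  next
    fix x assume x: "x \<in> nonunits"
    show "\<ominus> x \<in> nonunits" using mult[OF x, of "\<ominus> \<one>"] x by (simp add: l_minus)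
  next
    fix x y assume x: "x \<in> nonunits" and y: "y \<in> nonunits"
    have "x \<oplus> y \<notin> Units R"
    proof
      assume u: "x \<oplus> y \<in> Units R"
      let ?v = "inv (x \<oplus> y)"
      have v: "?v \<in> carrier R" "?v \<otimes> (x \<oplus> y) = \<one>" using u by auto
      have c: "x \<in> carrier R" "y \<in> carrier R" using x y by auto
      have "\<one> = ?v \<otimes> x \<oplus> ?v \<otimes> y" using v c r_distr[of x y ?v] by simp
      then have "\<one> \<ominus> ?v \<otimes> x = ?v \<otimes> y" using add_minus_cancel(1)[of "?v \<otimes> x" "?v \<otimes> y"] v c by simp
      then have "\<one> \<ominus> ?v \<otimes> x \<notin> Units R" "?v \<otimes> x \<notin> Units R"
        using mult[OF x v(1)] mult[OF y v(1)] by auto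
      moreover have "?v \<otimes> x \<in> carrier R" using v c by simp
      ultimately show False using loc unfolding is_local_def by blast
    qed
    then show "x \<oplus> y \<in> nonunits" using x y by auto
  qed (rule Diff_subset)
qed

lemma (in domain) proper_ideal_subset_nonunits:
  assumes "ideal I R" "I \<noteq> carrier R"
  shows "I \<subseteq> nonunits"
proof
  fix x assume x: "x \<in> I"
  have "x \<notin> Units R"
  proof
    assume u: "x \<in> Units R"
    then have "\<one> \<in> I" using ideal.I_r_closed[OF assms(1) x, of "inv x"] by simp
    then show False using ideal.one_imp_carrier[OF assms(1)] assms(2) by simp
  qed
  then show "x \<in> nonunits" using ideal.Icarr[OF assms(1) x] by simp
qed

lemma (in domain) maximalideal_iff_nonunits:
  assumes loc: is_local
  shows "maximalideal m R \<longleftrightarrow> m = nonunits"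
proof (rule iffI)
  have ne: "carrier R \<noteq> nonunits" using Units_one_closed one_closed by (metis DiffD2)
  show "m = nonunits" if m: "maximalideal m R"
  proof -
    have "ideal m R" using m by (rule maximalideal.axioms(1))
    then have "m \<subseteq> nonunits"
      using proper_ideal_subset_nonunits maximalideal.I_notcarr[OF m] by simp
    then show ?thesis
      using maximalideal.I_maximal[OF m nonunits_ideal[OF loc] _ Diff_subset] ne by simp
  qed
  show "maximalideal m R" if m: "m = nonunits"
    unfolding m
  proof (rule maximalidealI[OF nonunits_ideal[OF loc] ne])
    fix J assume J: "ideal J R" "nonunits \<subseteq> J"
    then show "J = nonunits \<or> J = carrier R"
      using proper_ideal_subset_nonunits[OF J(1)] by (metis subset_antisym)
  qed
qed

lemma (in domain) the_maximalideal:
  assumes is_local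
  shows "(THE m. maximalideal m R) = nonunits"
  by (rule the_equality) (simp_all add: maximalideal_iff_nonunits[OF assms])

lemma (in domain) valuation_local:
  assumes val: "\<And>a b. a \<in> carrier R \<Longrightarrow> b \<in> carrier R \<Longrightarrow> a divides b \<or> b divides a"
  shows is_local
  unfolding is_local_def
proof
  fix x assume x: "x \<in> carrier R"
  let ?y = "\<one> \<ominus> x"
  have y: "?y \<in> carrier R" "x \<oplus> ?y = \<one>" "?y \<oplus> x = \<one>"
    using x add_minus_cancel[of \<one> x] by auto
  from val[OF x y(1)] show "x \<in> Units R \<or> ?y \<in> Units R"
  proof
    assume "x divides ?y"
    then have "x divides (x \<oplus> ?y)" using divides_add[OF x divides_refl[OF x]] by blast
    then show ?thesis using divides_unit[OF _ x Units_one_closed] y(2) by simp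
  next
    assume "?y divides x"
    then have "?y divides (?y \<oplus> x)" using divides_add[OF y(1) divides_refl[OF y(1)]] by blast
    then show ?thesis using divides_unit[OF _ y(1) Units_one_closed] y(3) by simp
  qed
qed

text \<open>Ideals are finitely generated, and among finitely many pairwise comparable generators
  one divides all others, so every ideal is principal.\<close>

lemma (in noetherian_domain) valuation_DVR:
  assumes val: "\<And>a b. a \<in> carrier R \<Longrightarrow> b \<in> carrier R \<Longrightarrow> a divides b \<or> b divides a"
    and "\<not> field R"
  shows "DVR R"
proof -
  have gen: "\<exists>a\<in>A. A \<subseteq> PIdl a" if "finite A" "A \<noteq> {}" "A \<subseteq> carrier R" for A
    using that
  proof (induction A rule: finite_ne_induct)
    case (singleton x)
    then show ?case using cgenideal_self by blast
  next
    case (insert x A)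
    then obtain a where a: "a \<in> A" "A \<subseteq> PIdl a" by blast
    have c: "x \<in> carrier R" "a \<in> carrier R" using insert a by auto
    from val[OF c] show ?case
    proof
      assume "x divides a"
      then have "PIdl a \<subseteq> PIdl x" using to_contain_is_to_divide c by blast
      then show ?thesis using a cgenideal_self[OF c(1)] by blast
    next
      assume "a divides x"
      then have "PIdl x \<subseteq> PIdl a" using to_contain_is_to_divide c by blast
      then show ?thesis using a cgenideal_self[OF c(1)] by blast
    qed
  qed
  have "\<exists>a\<in>carrier R. I = PIdl a" if I: "ideal I R" for I
  proof -
    obtain A where A: "A \<subseteq> carrier R" "finite A" "I = Idl A" using finetely_gen[OF I] by blast
    \<comment> \<open>Adding zero makes the generating set nonempty without enlarging the
      ideal.\<close>
    let ?A = "insert \<zero> A"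
    obtain a where a: "a \<in> ?A" "?A \<subseteq> PIdl a" using gen[of ?A] A by auto
    have c: "a \<in> carrier R" using a(1) A(1) by auto
    have "a \<in> I" using a(1) genideal_self[OF A(1)] A(3)
      additive_subgroup.zero_closed[OF ideal.axioms(1)[OF I]] by auto
    then have "PIdl a \<subseteq> I" using cgenideal_minimal[OF I] by blast
    moreover have "I \<subseteq> PIdl a" unfolding A(3) using genideal_minimal[OF cgenideal_ideal[OF c]] a(2) by blast
    ultimately show ?thesis using c by blast
  qed
  then have "principal_domain R" by unfold_locales
  moreover have "\<exists>!m. maximalideal m R"
    using maximalideal_iff_nonunits[OF valuation_local[OF val]] by simp
  ultimately show ?thesis using assms(2) unfolding DVR_def by blast
qed

lemma (in domain) field_iff_no_nonunit:
  "field R \<longleftrightarrow> (\<forall>x\<in>carrier R. x \<noteq> \<zero> \<longrightarrow> x \<in> Units R)"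
proof (rule iffI)
  assume "field R"
  then show "\<forall>x\<in>carrier R. x \<noteq> \<zero> \<longrightarrow> x \<in> Units R" by (simp add: field.field_Units)
next
  assume *: "\<forall>x\<in>carrier R. x \<noteq> \<zero> \<longrightarrow> x \<in> Units R"
  have "Units R = carrier R - {\<zero>}"
  proof (rule Set.set_eqI)
    show "x \<in> Units R \<longleftrightarrow> x \<in> carrier R - {\<zero>}" for x
      using bspec[OF *, of x] zero_not_unit Units_closed[of x] by blast
  qed
  then show "field R" by (rule cring_fieldI)
qed

subsection \<open>Divisibility in dp-minimal domains\<close>

lemma (in cring) divides_add_iff:
  assumes "b \<in> carrier R" "x \<in> carrier R" "y \<in> carrier R" "b divides y"
  shows "b divides (x \<oplus> y) \<longleftrightarrow> b divides x"
proof
  assume "b divides (x \<oplus> y)"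
  from divides_minus[OF assms(1) this assms(4)] show "b divides x"
    using add_minus_cancel(1)[of y x] a_comm[of x y] assms(2,3) by simp
qed (rule divides_add[OF assms(1) _ assms(4)])

lemma (in cring) mem_coset_iff:
  assumes "b \<in> carrier R" "x \<in> carrier R" "c \<in> carrier R"
  shows "(\<exists>y\<in>carrier R. x = b \<otimes> y \<oplus> c) \<longleftrightarrow> b divides (x \<ominus> c)"
proof
  assume "\<exists>y\<in>carrier R. x = b \<otimes> y \<oplus> c"
  then obtain y where y: "y \<in> carrier R" "x = b \<otimes> y \<oplus> c" by (elim bexE)
  then have "x \<ominus> c = b \<otimes> y"
    using add_minus_cancel(1)[of c "b \<otimes> y"] a_comm[of c "b \<otimes> y"] assms by simp
  then show "b divides (x \<ominus> c)" using y(1) by (rule dividesI[rotated])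
next
  assume "b divides (x \<ominus> c)"
  then obtain y where "x \<ominus> c = b \<otimes> y" "y \<in> carrier R" by (rule dividesE)
  then show "\<exists>y\<in>carrier R. x = b \<otimes> y \<oplus> c"
    using add_minus_cancel(3)[of x c] assms by (intro bexI[of _ y]) simp_all
qed

lemma (in cring) divides_minus_commute:
  assumes "b \<in> carrier R" "x \<in> carrier R" "y \<in> carrier R" "z \<in> carrier R" "b divides (x \<ominus> y) \<otimes> z"
  shows "b divides (y \<ominus> x) \<otimes> z"
proof -
  have "\<ominus> ((x \<ominus> y) \<otimes> z) = (y \<ominus> x) \<otimes> z" using assms(2-4) by algebra
  then show ?thesis using divides_a_inv[OF assms(1,5)] by simp
qed

text \<open>The pattern consists of the cosets \<open>r k \<otimes> a + (b)\<close> and \<open>s k \<otimes> b + (a)\<close>.\<close>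

lemma (in domain) dp_minimal_coset_bound:
  assumes "dp_minimal R"
  obtains N :: nat where "\<And>a b r s. a \<in> carrier R \<Longrightarrow> b \<in> carrier R \<Longrightarrow>
    range r \<subseteq> carrier R \<Longrightarrow> range s \<subseteq> carrier R \<Longrightarrow>
    (\<exists>i j. i < j \<and> j < N \<and> b divides (r i \<ominus> r j) \<otimes> a) \<or>
    (\<exists>i j. i < j \<and> j < N \<and> a divides (s i \<ominus> s j) \<otimes> b)"
proof -
  \<comment> \<open>One formula serves both families: membership of variable 0 in a coset whose
    modulus and representative are the parameters 1 and 2.\<close>
  define f where "f = Ex 3 (Eq (Var 0) (Add (Mul (Var 1) (Var 3)) (Var 2)))"
  have "\<exists>n. \<not> ict2_finite R f f n" using assms not_dp_minimalI by metis
  then obtain N where N: "\<not> ict2_finite R f f N" by (elim exE)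
  have "(\<exists>i j. i < j \<and> j < N \<and> b divides (r i \<ominus> r j) \<otimes> a) \<or>
    (\<exists>i j. i < j \<and> j < N \<and> a divides (s i \<ominus> s j) \<otimes> b)"
    if ab: "a \<in> carrier R" "b \<in> carrier R" and "range r \<subseteq> carrier R" "range s \<subseteq> carrier R"
    for a b and r s :: "nat \<Rightarrow> 'a"
  proof (rule ccontr)
    assume neg: "\<not> ?thesis"
    have r: "r i \<in> carrier R" and s: "s i \<in> carrier R" for i using that(3,4) by auto
    have key: "b divides (r i \<ominus> r k) \<otimes> a \<longleftrightarrow> k = i" "a divides (s i \<ominus> s k) \<otimes> b \<longleftrightarrow> k = i"
      if "i < N" "k < N" for i k
    proof -
      have "r i \<ominus> r i = \<zero>" "s i \<ominus> s i = \<zero>" using r s by (simp_all add: minus_eq r_neg)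
      then have "b divides (r i \<ominus> r i) \<otimes> a" "a divides (s i \<ominus> s i) \<otimes> b"
        using ab by (auto intro: dividesI[of \<zero>])
      moreover have False if "b divides (r i \<ominus> r k) \<otimes> a" "i \<noteq> k"
        using neg that divides_minus_commute[OF ab(2) r[of i] r[of k] ab(1)] \<open>i < N\<close> \<open>k < N\<close>
        by (metis linorder_neqE_nat)
      moreover have False if "a divides (s i \<ominus> s k) \<otimes> b" "i \<noteq> k"
        using neg that divides_minus_commute[OF ab(1) s[of i] s[of k] ab(2)] \<open>i < N\<close> \<open>k < N\<close>
        by (metis linorder_neqE_nat)
      ultimately show "b divides (r i \<ominus> r k) \<otimes> a \<longleftrightarrow> k = i" "a divides (s i \<ominus> s k) \<otimes> b \<longleftrightarrow> k = i"
        by metis+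
    qed
    define E where "E p c = (\<lambda>v::nat. if v = 1 then p else if v = 2 then c else \<zero>)" for p c :: 'a
    have sat: "sat R ((E p c)(0 := x)) f \<longleftrightarrow> p divides (x \<ominus> c)"
      if "p \<in> carrier R" "c \<in> carrier R" "x \<in> carrier R" for p c x
      using mem_coset_iff[OF that(1,3,2)] by (simp add: E_def f_def)
    have E: "range (E p c) \<subseteq> carrier R" if "p \<in> carrier R" "c \<in> carrier R" for p c
      using that by (auto simp: E_def)
    \<comment> \<open>Modulo \<open>b\<close> the second summand disappears and only
      \<open>i\<close> remains visible; modulo \<open>a\<close> only \<open>j\<close> does.\<close>
    let ?x = "\<lambda>i j. r i \<otimes> a \<oplus> s j \<otimes> b"
    have "b divides (?x i j \<ominus> r k \<otimes> a) \<longleftrightarrow> k = i" "a divides (?x i j \<ominus> s k \<otimes> b) \<longleftrightarrow> k = j"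
      if "i < N" "j < N" "k < N" for i j k
    proof -
      have "?x i j \<ominus> r k \<otimes> a = (r i \<ominus> r k) \<otimes> a \<oplus> b \<otimes> s j"
        "?x i j \<ominus> s k \<otimes> b = (s j \<ominus> s k) \<otimes> b \<oplus> a \<otimes> r i"
        using r[of i] r[of k] s[of j] s[of k] ab by algebra+
      then show "b divides (?x i j \<ominus> r k \<otimes> a) \<longleftrightarrow> k = i" "a divides (?x i j \<ominus> s k \<otimes> b) \<longleftrightarrow> k = j"
        using key that divides_add_iff[of b "(r i \<ominus> r k) \<otimes> a" "b \<otimes> s j"]
          divides_add_iff[of a "(s j \<ominus> s k) \<otimes> b" "a \<otimes> r i"] r s ab
        by (simp_all add: dividesI[of "s j"] dividesI[of "r i"])
    qed
    then have "ict2_finite R f f N"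
      unfolding ict2_finite_def using ab r s E
      by (rule_tac exI[of _ "\<lambda>k. E b (r k \<otimes> a)"], rule_tac exI[of _ "\<lambda>k. E a (s k \<otimes> b)"],
          rule_tac exI[of _ ?x]) (simp add: sat)
    then show False using N by contradiction
  qed
  then show ?thesis by (rule that)
qed

text \<open>Modulo \<open>b\<close> the factor in front of \<open>x\<close> is congruent to
  1.\<close>

lemma (in cring) base_divides_power_minus:
  assumes "b \<in> carrier R" "x \<in> carrier R" "b divides (\<one> \<ominus> b [^] Suc k) \<otimes> x"
  shows "b divides x"
proof -
  have 1: "b divides (b [^] Suc k \<otimes> x)"
    using assms(1,2) by (intro dividesI[of "b [^] k \<otimes> x"]) (simp_all add: m_ac)
  have "(\<one> \<ominus> b [^] Suc k) \<otimes> x \<oplus> b [^] Suc k \<otimes> x = x"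
    using assms(1,2) nat_pow_closed[OF assms(1), of "Suc k"] by algebra
  then show ?thesis using divides_add[OF assms(1,3) 1] by simp
qed

text \<open>The exponent \<open>Suc (j - Suc i)\<close> is \<open>j - i\<close>, written so that it
  is visibly positive.\<close>

lemma (in cring) power_minus_power:
  assumes "b \<in> carrier R" "i < j"
  shows "b [^] i \<ominus> b [^] j = b [^] (i::nat) \<otimes> (\<one> \<ominus> b [^] Suc (j - Suc i))"
proof -
  have "b [^] j = b [^] i \<otimes> b [^] Suc (j - Suc i)" using assms by (subst nat_pow_mult) simp_all
  then show ?thesis using assms(1) nat_pow_closed[OF assms(1), of i]
    nat_pow_closed[OF assms(1), of "Suc (j - Suc i)"] by algebra
qed

lemma (in domain) divides_if_power_divides:
  assumes b: "b \<in> carrier R" "b \<noteq> \<zero>" and x: "x \<in> carrier R" and ij: "i < j" "j < (N::nat)"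
    and d: "b [^] N divides (b [^] i \<ominus> b [^] j) \<otimes> x"
  shows "b divides x"
proof -
  let ?k = "j - Suc i" and ?l = "N - Suc i"
  have c: "b [^] i \<in> carrier R" "b [^] i \<noteq> \<zero>" "\<one> \<ominus> b [^] Suc ?k \<in> carrier R"
    using b nat_pow_nonzero by simp_all
  have N: "b [^] N = b [^] i \<otimes> b [^] Suc ?l" using b ij by (subst nat_pow_mult) simp_all
  from d obtain t where t: "(b [^] i \<ominus> b [^] j) \<otimes> x = b [^] N \<otimes> t" "t \<in> carrier R" by (rule dividesE)
  have "b [^] i \<otimes> ((\<one> \<ominus> b [^] Suc ?k) \<otimes> x) = b [^] i \<otimes> (b [^] Suc ?l \<otimes> t)"
    using t c x b m_assoc unfolding power_minus_power[OF b(1) ij(1)] N by simp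
  then have "(\<one> \<ominus> b [^] Suc ?k) \<otimes> x = b [^] Suc ?l \<otimes> t"
    using m_lcancel[OF c(2,1)] c(3) x t(2) b(1) by simp
  also have "\<dots> = b \<otimes> (b [^] ?l \<otimes> t)" using b t(2) by (simp add: m_ac)
  finally have "b divides (\<one> \<ominus> b [^] Suc ?k) \<otimes> x"
    using b t(2) by (intro dividesI[of "b [^] ?l \<otimes> t"]) simp_all
  then show ?thesis using base_divides_power_minus b(1) x by metis
qed

lemma (in cring) divides_one_minus_power:
  assumes "a \<in> carrier R" "b \<in> carrier R" "a \<oplus> b = \<one>"
  shows "b divides (\<one> \<ominus> a [^] (n::nat))"
proof (induction n)
  case 0
  show ?case using assms by (intro dividesI[of \<zero>]) (simp_all add: minus_eq r_neg)
next
  case (Suc n)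
  have "\<one> \<ominus> a [^] Suc n = (\<one> \<ominus> a [^] n) \<oplus> (\<one> \<ominus> a) \<otimes> a [^] n"
    using assms(1) nat_pow_closed[OF assms(1), of n] unfolding nat_pow_Suc by algebra
  moreover have "\<one> \<ominus> a = b" using add_minus_cancel(1)[of a b] assms by simp
  ultimately show ?case
    using Suc divides_add[OF assms(2) Suc, of "b \<otimes> a [^] n"] assms(1)
    by (simp add: dividesI[of "a [^] n"])
qed

lemma (in domain) comaximal_powers_unit:
  assumes "a \<in> carrier R" "b \<in> carrier R" "a \<oplus> b = \<one>" "b \<noteq> \<zero>" "i < j" "j < (N::nat)"
    and "b [^] N divides (b [^] i \<ominus> b [^] j) \<otimes> a [^] (n::nat)"
  shows "b \<in> Units R"
proof -
  have c: "a [^] n \<in> carrier R" using assms(1) by simp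
  have "b divides a [^] n"
    using divides_if_power_divides[OF assms(2,4) c assms(5,6,7)] .
  from divides_add[OF assms(2) this divides_one_minus_power[OF assms(1,2,3), of n]]
  have "b divides \<one>" using add_minus_cancel(2)[OF one_closed c] by simp
  then show ?thesis using divides_unit assms(2) by simp
qed

lemma (in domain) dp_minimal_local:
  assumes "dp_minimal R"
  shows is_local
  unfolding is_local_def
proof (rule ballI, rule ccontr)
  fix x assume x: "x \<in> carrier R" and neg: "\<not> (x \<in> Units R \<or> \<one> \<ominus> x \<in> Units R)"
  let ?y = "\<one> \<ominus> x"
  have y: "?y \<in> carrier R" and xy: "x \<oplus> ?y = \<one>" "?y \<oplus> x = \<one>"
    using x add_minus_cancel[of \<one> x] by simp_all
  have nz: "x \<noteq> \<zero>" "?y \<noteq> \<zero>" using neg xy x y Units_one_closed by (metis r_zero, metis r_zero)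
  obtain N where N: "\<And>a b r s. a \<in> carrier R \<Longrightarrow> b \<in> carrier R \<Longrightarrow>
    range r \<subseteq> carrier R \<Longrightarrow> range s \<subseteq> carrier R \<Longrightarrow>
    (\<exists>i j. i < j \<and> j < N \<and> b divides (r i \<ominus> r j) \<otimes> a) \<or>
    (\<exists>i j. i < j \<and> j < (N::nat) \<and> a divides (s i \<ominus> s j) \<otimes> b)"
    using dp_minimal_coset_bound[OF assms] by metis
  have "range (\<lambda>i::nat. x [^] i) \<subseteq> carrier R" "range (\<lambda>i::nat. ?y [^] i) \<subseteq> carrier R"
    using x y by auto
  \<comment> \<open>The multipliers modulo the power of \<open>?y\<close> are powers of
    \<open>?y\<close>, those modulo the power of \<open>x\<close> are powers of \<open>x\<close>;
    hence the swapped order of the range facts.\<close>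
  from N[OF nat_pow_closed[OF x, of N] nat_pow_closed[OF y, of N] this(2,1)]
  show False
  proof (elim disjE exE conjE)
    fix i j :: nat assume "i < j" "j < N" "?y [^] N divides (?y [^] i \<ominus> ?y [^] j) \<otimes> x [^] N"
    then show False using comaximal_powers_unit[OF x y xy(1) nz(2)] neg by metis
  next
    fix i j :: nat assume "i < j" "j < N" "x [^] N divides (x [^] i \<ominus> x [^] j) \<otimes> ?y [^] N"
    then show False using comaximal_powers_unit[OF y x xy(2) nz(1)] neg by metis
  qed
qed

section \<open>Comparability of elements, exactly or up to a fixed factor\<close>

lemma (in cring) divides_cancel_unit:
  assumes "u \<in> Units R" "x \<in> carrier R" "b \<in> carrier R" "b divides u \<otimes> x"
  shows "b divides x"
proof -
  have "b divides inv u \<otimes> (u \<otimes> x)" using divides_mult(2)[OF assms(3,4), of "inv u"] assms(1,2)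
    Units_closed[OF assms(1)] by simp
  moreover have "inv u \<otimes> (u \<otimes> x) = x"
    using assms Units_closed[OF assms(1)] m_assoc[of "inv u" u x] by simp
  ultimately show ?thesis by simp
qed

lemma (in domain) dp_minimal_weak_valuation:
  assumes "dp_minimal R" "y \<in> nonunits"
  obtains N :: nat where "\<And>a b. a \<in> carrier R \<Longrightarrow> b \<in> carrier R \<Longrightarrow>
    b divides y [^] N \<otimes> a \<or> a divides y [^] N \<otimes> b"
proof -
  obtain N where N: "\<And>a b r s. a \<in> carrier R \<Longrightarrow> b \<in> carrier R \<Longrightarrow>
    range r \<subseteq> carrier R \<Longrightarrow> range s \<subseteq> carrier R \<Longrightarrow>
    (\<exists>i j. i < j \<and> j < N \<and> b divides (r i \<ominus> r j) \<otimes> a) \<or>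
    (\<exists>i j. i < j \<and> j < (N::nat) \<and> a divides (s i \<ominus> s j) \<otimes> b)"
    using dp_minimal_coset_bound[OF assms(1)] by metis
  have y: "y \<in> carrier R" using assms(2) by (rule DiffD1)
  have aux: "b divides y [^] N \<otimes> a"
    if "a \<in> carrier R" "b \<in> carrier R" "i < j" "j < N" "b divides (y [^] i \<ominus> y [^] j) \<otimes> a" for a b i j
  proof -
    let ?k = "j - Suc i"
    have "y [^] Suc ?k \<in> nonunits"
      using ideal.I_l_closed[OF nonunits_ideal[OF dp_minimal_local[OF assms(1)]] assms(2), of "y [^] ?k"] y
      by simp
    then have u: "\<one> \<ominus> y [^] Suc ?k \<in> Units R" using dp_minimal_local[OF assms(1)] y
      unfolding is_local_def by (metis DiffD1 DiffD2)
    have "(y [^] i \<ominus> y [^] j) \<otimes> a = (\<one> \<ominus> y [^] Suc ?k) \<otimes> (y [^] i \<otimes> a)"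
      unfolding power_minus_power[OF y that(3)] using y that(1) by (simp add: m_ac del: nat_pow_Suc)
    then have "b divides y [^] i \<otimes> a" using divides_cancel_unit[OF u _ that(2)] that y by simp
    then have "b divides y [^] (N - i) \<otimes> (y [^] i \<otimes> a)" using that y by (simp add: divides_mult)
    moreover have "y [^] (N - i) \<otimes> (y [^] i \<otimes> a) = y [^] N \<otimes> a"
      using that y by (simp add: m_assoc[symmetric] nat_pow_mult)
    ultimately show ?thesis by simp
  qed
  have "range (\<lambda>i::nat. y [^] i) \<subseteq> carrier R" using y by auto
  then have "b divides y [^] N \<otimes> a \<or> a divides y [^] N \<otimes> b"
    if "a \<in> carrier R" "b \<in> carrier R" for a b
    using N[OF that, of "\<lambda>i. y [^] i" "\<lambda>i. y [^] i"] aux[OF that] aux[OF that(2,1)] by metis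
  then show ?thesis by (rule that)
qed

lemma (in domain) dp_minimal_valuation:
  assumes "dp_minimal R" "\<not> finite_index nonunits" "a \<in> carrier R" "b \<in> carrier R"
  shows "a divides b \<or> b divides a"
proof -
  have m: "ideal nonunits R" using nonunits_ideal dp_minimal_local[OF assms(1)] by simp
  obtain r :: "nat \<Rightarrow> 'a" where r: "range r \<subseteq> carrier R" "\<And>i j. i \<noteq> j \<Longrightarrow> r i \<ominus> r j \<notin> nonunits"
    using infinite_index_sequence[OF ideal.axioms(1)[OF m] assms(2)] by metis
  have unit: "r i \<ominus> r j \<in> Units R" if "i < j" for i j
    using r(2)[of i j] range_subsetD[OF r(1)] that by simp
  obtain N where N: "\<And>a b r s. a \<in> carrier R \<Longrightarrow> b \<in> carrier R \<Longrightarrow>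
    range r \<subseteq> carrier R \<Longrightarrow> range s \<subseteq> carrier R \<Longrightarrow>
    (\<exists>i j. i < j \<and> j < N \<and> b divides (r i \<ominus> r j) \<otimes> a) \<or>
    (\<exists>i j. i < j \<and> j < (N::nat) \<and> a divides (s i \<ominus> s j) \<otimes> b)"
    using dp_minimal_coset_bound[OF assms(1)] by metis
  from N[OF assms(3,4) r(1) r(1)] show ?thesis
    using divides_cancel_unit[OF unit assms(3,4)] divides_cancel_unit[OF unit assms(4,3)] by metis
qed

subsection \<open>Residue characteristic\<close>

lemma (in cring) binomial:
  assumes x: "x \<in> carrier R" and y: "y \<in> carrier R"
  shows "(x \<oplus> y) [^] (n::nat) = (\<Oplus>k\<in>{..n}. add_pow R (n choose k) (x [^] k \<otimes> y [^] (n - k)))"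
proof (induction n)
  case 0
  show ?case using x y by simp
next
  case (Suc n)
  define A where "A k = add_pow R (n choose k) (x [^] Suc k \<otimes> y [^] (n - k))" for k
  define B where "B k = add_pow R (n choose k) (x [^] k \<otimes> y [^] (Suc n - k))" for k
  have cl: "A k \<in> carrier R" "B k \<in> carrier R" for k using x y unfolding A_def B_def by simp_all
  have "(x \<oplus> y) [^] Suc n = (x \<oplus> y) [^] n \<otimes> x \<oplus> (x \<oplus> y) [^] n \<otimes> y"
    using x y by (simp add: r_distr)
  also have "(x \<oplus> y) [^] n \<otimes> x = (\<Oplus>k\<in>{..n}. A k)"
    unfolding Suc using x y
    by (subst finsum_ldistr) (auto intro!: finsum_cong' simp: A_def add_pow_ldistr add_pow_rdistr m_ac)
  also have "(x \<oplus> y) [^] n \<otimes> y = (\<Oplus>k\<in>{..n}. B k)"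
    unfolding Suc using x y
    by (subst finsum_ldistr) (auto intro!: finsum_cong' simp: B_def add_pow_ldistr m_assoc Suc_diff_le)
  \<comment> \<open>The added term has coefficient \<open>n choose Suc n\<close>, which is 0; it
    lines the sums up for Pascal's rule.\<close>
  also have "(\<Oplus>k\<in>{..n}. B k) = (\<Oplus>k\<in>{..Suc n}. B k)"
    using cl by simp (simp add: B_def binomial_eq_0)
  also have "\<dots> = (\<Oplus>k\<in>{..n}. B (Suc k)) \<oplus> B 0"
    using cl by (subst finsum_Suc2) auto
  also have "(\<Oplus>k\<in>{..n}. A k) \<oplus> ((\<Oplus>k\<in>{..n}. B (Suc k)) \<oplus> B 0) =
      (\<Oplus>k\<in>{..n}. A k \<oplus> B (Suc k)) \<oplus> B 0"
    using cl by (subst finsum_addf) (auto simp: a_assoc)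
  also have "\<dots> = (\<Oplus>k\<in>{..n}. add_pow R (Suc n choose Suc k) (x [^] Suc k \<otimes> y [^] (Suc n - Suc k))) \<oplus> B 0"
    using x y by (simp add: A_def B_def add.nat_pow_mult del: nat_pow_Suc)
  also have "\<dots> = (\<Oplus>k\<in>{..Suc n}. add_pow R (Suc n choose k) (x [^] k \<otimes> y [^] (Suc n - k)))"
    using x y by (subst finsum_Suc2) (auto simp: B_def)
  finally show ?case .
qed

text \<open>The prime divides the inner binomial coefficients, and each inner term contains
  \<open>x\<close>. The factor \<open>x\<close> stays visible in the error term because a multiple
  of \<open>t\<close> is later put in its place, which makes the error divisible by the square of
  \<open>t\<close>.\<close>

lemma (in cring) power_add_prime:
  assumes x: "x \<in> carrier R" and y: "y \<in> carrier R" and p: "Factorial_Ring.prime (p::nat)"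
  obtains w where "w \<in> carrier R" "(x \<oplus> y) [^] p = x [^] p \<oplus> y [^] p \<oplus> add_pow R p \<one> \<otimes> (x \<otimes> w)"
proof -
  \<comment> \<open>With \<open>p = l + 2\<close> the inner indices are \<open>Suc k\<close> for
    \<open>k \<le> l\<close>; the two outer terms are split off at either end.\<close>
  obtain l where "p = 2 + l" using le_Suc_ex[OF prime_ge_2_nat[OF p]] by (elim exE)
  then have l: "p = Suc (Suc l)" by simp
  define W where "W k = add_pow R ((p choose Suc k) div p) (x [^] k \<otimes> y [^] (p - Suc k))" for k
  have W: "W k \<in> carrier R" for k using x y unfolding W_def by simp
  have summand: "add_pow R (p choose Suc k) (x [^] Suc k \<otimes> y [^] (p - Suc k)) = add_pow R p \<one> \<otimes> x \<otimes> W k"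
    if "k \<le> l" for k
  proof -
    define c where "c = (p choose Suc k) div p"
    have "p dvd (p choose Suc k)" using p that by (intro dvd_choose_prime) (auto simp: l)
    then have c: "(p choose Suc k) = c * p" unfolding c_def by simp
    have "add_pow R p \<one> \<otimes> x \<otimes> W k = add_pow R p (x \<otimes> W k)"
      using x W by (simp add: add_pow_ldistr m_assoc)
    also have "x \<otimes> W k = add_pow R c (x [^] Suc k \<otimes> y [^] (p - Suc k))"
      using x y unfolding W_def c_def[symmetric] by (simp add: add_pow_rdistr m_ac)
    also have "add_pow R p \<dots> = add_pow R (c * p) (x [^] Suc k \<otimes> y [^] (p - Suc k))"
      using x y by (simp add: add.nat_pow_pow del: nat_pow_Suc)
    finally show ?thesis unfolding c by simp
  qed
  have "(x \<oplus> y) [^] p = (\<Oplus>k\<in>{..Suc (Suc l)}. add_pow R (p choose k) (x [^] k \<otimes> y [^] (p - k)))"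
    using binomial[OF x y, of p] unfolding l .
  also have "\<dots> = add_pow R (p choose p) (x [^] p \<otimes> y [^] (p - p)) \<oplus>
      ((\<Oplus>k\<in>{..l}. add_pow R (p choose Suc k) (x [^] Suc k \<otimes> y [^] (p - Suc k))) \<oplus>
       add_pow R (p choose 0) (x [^] (0::nat) \<otimes> y [^] (p - 0)))"
    using x y by (subst finsum_Suc, simp, subst finsum_Suc2, simp, simp only: l)
  also have "(\<Oplus>k\<in>{..l}. add_pow R (p choose Suc k) (x [^] Suc k \<otimes> y [^] (p - Suc k))) =
      (\<Oplus>k\<in>{..l}. add_pow R p \<one> \<otimes> x \<otimes> W k)"
    using x W summand by (intro finsum_cong') (auto simp del: nat_pow_Suc)
  also have "\<dots> = add_pow R p \<one> \<otimes> x \<otimes> (\<Oplus>k\<in>{..l}. W k)"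
    using x W by (subst finsum_rdistr) auto
  finally show ?thesis using x y W that[of "\<Oplus>k\<in>{..l}. W k"]
    by (simp add: a_ac m_assoc)
qed

lemma (in domain) divides_of_power:
  assumes prime: "\<And>x y. x \<in> carrier R \<Longrightarrow> y \<in> carrier R \<Longrightarrow> t divides x \<otimes> y \<Longrightarrow> t divides x \<or> t divides y"
    and "x \<in> carrier R" "t divides x [^] Suc n"
  shows "t divides x"
  using assms(3)
proof (induction n)
  case (Suc n)
  then show ?case using prime[of "x [^] Suc n" x] assms(2) by auto
qed (use assms(2) in simp)

text \<open>If \<open>t\<close> is prime and divides the integer \<open>p\<close>, the map \<open>x \<mapsto> x [^] p\<close> induces an injection of the
  residue ring modulo \<open>t\<close> into the one modulo \<open>t\<^sup>2\<close>; hence \<open>(x, y) \<mapsto> x [^] p \<oplus> t \<otimes> y [^] p\<close> embeds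
  two independent copies of the former into the latter.\<close>

locale residue_char_p = "domain" R for R (structure) +
  fixes t :: 'a and p :: nat
  assumes t: "t \<in> carrier R" "t \<noteq> \<zero>"
    and t_prime: "\<And>x y. x \<in> carrier R \<Longrightarrow> y \<in> carrier R \<Longrightarrow> t divides x \<otimes> y \<Longrightarrow> t divides x \<or> t divides y"
    and p: "Factorial_Ring.prime p" and t_p: "t divides add_pow R p \<one>"
begin

lemma power_p_minus:
  assumes "x \<in> carrier R" "z \<in> carrier R"
  obtains w where "w \<in> carrier R"
    "x [^] p \<ominus> z [^] p = (x \<ominus> z) [^] p \<oplus> add_pow R p \<one> \<otimes> ((x \<ominus> z) \<otimes> w)"
proof -
  let ?u = "x \<ominus> z"
  have u: "?u \<in> carrier R" "?u \<oplus> z = x" using assms add_minus_cancel(3) by simp_all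
  obtain w where w: "w \<in> carrier R"
    "(?u \<oplus> z) [^] p = ?u [^] p \<oplus> z [^] p \<oplus> add_pow R p \<one> \<otimes> (?u \<otimes> w)"
    using power_add_prime[OF u(1) assms(2) p] by metis
  define Q where "Q = add_pow R p \<one> \<otimes> (?u \<otimes> w)"
  have "x [^] p = ?u [^] p \<oplus> z [^] p \<oplus> Q" using w(2) unfolding Q_def u(2) .
  moreover have "Q \<in> carrier R" using u w unfolding Q_def by simp
  ultimately have "x [^] p \<ominus> z [^] p = ?u [^] p \<oplus> Q"
    using nat_pow_closed[OF u(1), of p] nat_pow_closed[OF assms(2), of p] by algebra
  then show ?thesis using that[OF w(1)] unfolding Q_def by simp
qed

text \<open>With \<open>u = x - z\<close> divisible by \<open>t\<close>, the square of
  \<open>t\<close> divides \<open>u^p\<close> because \<open>p\<close> is at least 2, and it divides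
  the error term because that contains both the integer \<open>p\<close> and
  \<open>u\<close>.\<close>

lemma divides_power_p:
  assumes "x \<in> carrier R" "z \<in> carrier R" "t divides (x \<ominus> z)"
  shows "t \<otimes> t divides (x [^] p \<ominus> z [^] p)"
proof -
  let ?u = "x \<ominus> z"
  obtain w where w: "w \<in> carrier R"
    "x [^] p \<ominus> z [^] p = ?u [^] p \<oplus> add_pow R p \<one> \<otimes> (?u \<otimes> w)"
    using power_p_minus[OF assms(1,2)] by metis
  obtain v where v: "?u = t \<otimes> v" "v \<in> carrier R" using assms(3) by (rule dividesE)
  obtain q where q: "add_pow R p \<one> = t \<otimes> q" "q \<in> carrier R" using t_p by (rule dividesE)
  obtain l where "p = 2 + l" using le_Suc_ex[OF prime_ge_2_nat[OF p]] by (elim exE)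
  then have l: "p = Suc (Suc l)" by simp
  have "?u [^] p = (t \<otimes> t) \<otimes> (v \<otimes> v \<otimes> ?u [^] l)"
    using v t nat_pow_closed[of ?u l] unfolding l nat_pow_Suc by (simp add: m_ac)
  moreover have "add_pow R p \<one> \<otimes> (?u \<otimes> w) = (t \<otimes> t) \<otimes> (q \<otimes> (v \<otimes> w))"
    using v q w(1) t by (simp add: m_ac)
  ultimately show ?thesis unfolding w(2) using v q w(1) t
    by (intro divides_add dividesI[of "v \<otimes> v \<otimes> ?u [^] l"] dividesI[of "q \<otimes> (v \<otimes> w)"]) simp_all
qed

text \<open>Injectivity of the Frobenius map modulo the prime \<open>t\<close>: the error term
  vanishes modulo \<open>t\<close>, leaving \<open>(x - z)^p\<close>.\<close>

lemma divides_of_power_p: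
  assumes "x \<in> carrier R" "z \<in> carrier R" "t divides (x [^] p \<ominus> z [^] p)"
  shows "t divides (x \<ominus> z)"
proof -
  let ?u = "x \<ominus> z"
  obtain w where w: "w \<in> carrier R"
    "x [^] p \<ominus> z [^] p = ?u [^] p \<oplus> add_pow R p \<one> \<otimes> (?u \<otimes> w)"
    using power_p_minus[OF assms(1,2)] by metis
  have u: "?u \<in> carrier R" using assms by simp
  have "t divides (add_pow R p \<one> \<otimes> (?u \<otimes> w))"
    by (rule divides_mult(1)[OF t(1) t_p]) (use u w(1) in simp_all)
  then have "t divides ?u [^] p"
    using assms(3) divides_add_iff[OF t(1), of "?u [^] p"] u w(1) unfolding w(2) by simp
  then show ?thesis
    using divides_of_power[OF t_prime u, of "p - 1"] prime_gt_0_nat[OF p] by simp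
qed

text \<open>In the pattern of all \<open>x_i^p + t x_j^p\<close> the first formula reads off
  \<open>i\<close> modulo \<open>t\<close>. The second reads off \<open>j\<close> modulo
  \<open>t^2\<close>, where an existentially quantified \<open>p\<close>-th power absorbs the first
  summand.\<close>

lemma not_dp_minimal:
  fixes x :: "nat \<Rightarrow> 'a"
  assumes x: "\<And>i. x i \<in> carrier R" and distinct: "\<And>i j. i \<noteq> j \<Longrightarrow> \<not> t divides (x i \<ominus> x j)"
  shows "\<not> dp_minimal R"
proof -
  define f where "f = Ex 3 (Eq (Var 0) (Add (Mul (Var 1) (Var 3)) (Var 2)))"
  define g where "g = Ex 4 (Ex 3 (Eq (Var 0)
    (Add (Mul (Var 1) (Var 3)) (Add (Var 2) ((Mul (Var 4) ^^ (p - 1)) (Var 4))))))"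
  define E where "E b c = (\<lambda>v::nat. if v = 1 then b else if v = 2 then c else \<zero>)" for b c :: 'a
  have E: "range (E b c) \<subseteq> carrier R" if "b \<in> carrier R" "c \<in> carrier R" for b c
    using that by (auto simp: E_def)
  have satf: "sat R ((E b c)(0 := z)) f \<longleftrightarrow> b divides (z \<ominus> c)"
    if "b \<in> carrier R" "c \<in> carrier R" "z \<in> carrier R" for b c z
    using mem_coset_iff[OF that(1,3,2)] by (simp add: E_def f_def)
  have pow: "u [^] (p - Suc 0) \<otimes> u = u [^] p" if "u \<in> carrier R" for u
    using nat_pow_Suc[of u "p - 1"] prime_gt_0_nat[OF p] by simp
  have satg: "sat R ((E b c)(0 := z)) g \<longleftrightarrow> (\<exists>u\<in>carrier R. b divides (z \<ominus> (c \<oplus> u [^] p)))"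
    if "b \<in> carrier R" "c \<in> carrier R" "z \<in> carrier R" for b c z
  proof -
    have "sat R ((E b c)(0 := z)) g \<longleftrightarrow>
        (\<exists>u\<in>carrier R. \<exists>y\<in>carrier R. z = b \<otimes> y \<oplus> (c \<oplus> u [^] p))"
      unfolding g_def by (simp add: tm_eval_Mul_pow[OF ring_axioms] E_def pow)
    then show ?thesis using mem_coset_iff[OF that(1,3)] that(2) by simp
  qed
  have y: "x i [^] p \<in> carrier R" for i using x by simp
  let ?a = "\<lambda>i j. x i [^] p \<oplus> t \<otimes> x j [^] p"
  have eq: "t divides (x i [^] p \<ominus> x k [^] p) \<longleftrightarrow> k = i" for i k
  proof
    assume "t divides (x i [^] p \<ominus> x k [^] p)"
    then show "k = i" using divides_of_power_p[OF x x] distinct by metis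
  next
    assume "k = i"
    then have "x i [^] p \<ominus> x k [^] p = \<zero>" using y by (simp add: minus_eq r_neg)
    then show "t divides (x i [^] p \<ominus> x k [^] p)" using t(1) by (intro dividesI[of \<zero>]) simp_all
  qed
  have 1: "t divides (?a i j \<ominus> x k [^] p) \<longleftrightarrow> k = i" for i j k
  proof -
    have "?a i j \<ominus> x k [^] p = (x i [^] p \<ominus> x k [^] p) \<oplus> t \<otimes> x j [^] p"
      using y[of i] y[of j] y[of k] t(1) by algebra
    moreover have "t divides (t \<otimes> x j [^] p)" using y by (intro dividesI[of "x j [^] p"]) simp_all
    ultimately show ?thesis using divides_add_iff[OF t(1) minus_closed[OF y[of i] y[of k]],
        of "t \<otimes> x j [^] p"] y t(1) eq by simp
  qed
  \<comment> \<open>A congruence modulo the square of \<open>t\<close> first gives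
    \<open>x i\<close> congruent to \<open>u\<close> modulo \<open>t\<close>. Their
    \<open>p\<close>-th powers then agree modulo the square, and what remains is \<open>t\<close>
    times a difference of \<open>p\<close>-th powers, from which one \<open>t\<close>
    cancels.\<close>
  have 2: "(\<exists>u\<in>carrier R. t \<otimes> t divides (?a i j \<ominus> (t \<otimes> x k [^] p \<oplus> u [^] p))) \<longleftrightarrow> k = j" for i j k
  proof
    assume "k = j"
    then have "?a i j \<ominus> (t \<otimes> x k [^] p \<oplus> x i [^] p) = \<zero>" using y[of i] y[of j] t(1) by algebra
    then show "\<exists>u\<in>carrier R. t \<otimes> t divides (?a i j \<ominus> (t \<otimes> x k [^] p \<oplus> u [^] p))"
      using t(1) x by (intro bexI[of _ "x i"] dividesI[of \<zero>]) simp_all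
  next
    assume "\<exists>u\<in>carrier R. t \<otimes> t divides (?a i j \<ominus> (t \<otimes> x k [^] p \<oplus> u [^] p))"
    then obtain u where u: "u \<in> carrier R"
      and d: "t \<otimes> t divides (?a i j \<ominus> (t \<otimes> x k [^] p \<oplus> u [^] p))" by (elim bexE)
    let ?w = "x i [^] p \<ominus> u [^] p" and ?v = "x j [^] p \<ominus> x k [^] p"
    have c: "?w \<in> carrier R" "?v \<in> carrier R" "t \<otimes> ?v \<in> carrier R" using y u t(1) by simp_all
    have "?a i j \<ominus> (t \<otimes> x k [^] p \<oplus> u [^] p) = ?w \<oplus> t \<otimes> ?v"
      using y[of i] y[of j] y[of k] t(1) nat_pow_closed[OF u, of p] by algebra
    then have d: "t \<otimes> t divides (?w \<oplus> t \<otimes> ?v)" using d by simp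
    have "t divides (t \<otimes> t)" using t(1) by (intro dividesI[of t]) simp_all
    then have "t divides (?w \<oplus> t \<otimes> ?v)" using d t(1) by (rule divides_trans)
    moreover have "t divides (t \<otimes> ?v)" using c by (intro dividesI[of ?v]) simp_all
    ultimately have "t divides ?w" using divides_add_iff[OF t(1) c(1,3)] by simp
    then have "t \<otimes> t divides ?w" using divides_power_p[OF x u] divides_of_power_p[OF x u] by simp
    moreover have "t \<otimes> ?v \<oplus> ?w = ?w \<oplus> t \<otimes> ?v" using a_comm c by simp
    ultimately have "t \<otimes> t divides t \<otimes> ?v"
      using divides_add_iff[of "t \<otimes> t" "t \<otimes> ?v" ?w] d c t(1) by simp
    then obtain s where s: "t \<otimes> ?v = t \<otimes> t \<otimes> s" "s \<in> carrier R" by (rule dividesE)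
    then have "t \<otimes> ?v = t \<otimes> (t \<otimes> s)" using m_assoc t(1) by simp
    then have "?v = t \<otimes> s" using m_lcancel[OF t(2,1) c(2)] s(2) t(1) by simp
    then have "t divides ?v" using s(2) by (rule dividesI[rotated])
    then show "k = j" using eq by simp
  qed
  have "ict2_finite R f g n" for n
    unfolding ict2_finite_def
    by (rule_tac exI[of _ "\<lambda>k. E t (x k [^] p)"], rule_tac exI[of _ "\<lambda>k. E (t \<otimes> t) (t \<otimes> x k [^] p)"],
        rule_tac exI[of _ ?a]) (simp add: satf satg E 1 2 y t(1))
  then show ?thesis by (rule not_dp_minimalI)
qed

end

lemma (in domain) char_zero_residue:
  assumes dp: "dp_minimal R" and dvr: "DVR R" and inf: "\<not> finite_index nonunits"
  shows "char_zero_ring (R Quot nonunits)"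
proof (rule ccontr)
  let ?Q = "R Quot nonunits"
  note loc = dp_minimal_local[OF dp]
  note m = nonunits_ideal[OF loc]
  interpret m: ideal nonunits R by (rule m)
  obtain t where t: "t \<in> carrier R" "nonunits = PIdl t"
    using principal_domain.exists_gen[OF _ m] dvr unfolding DVR_def by metis
  have t_iff: "t divides x \<longleftrightarrow> x \<in> nonunits" if "x \<in> carrier R" for x
    unfolding t(2) cgenideal_def factor_def using that t(1) m_comm by auto
  have "t \<noteq> \<zero>"
  proof
    assume "t = \<zero>"
    then have "nonunits = {\<zero>}" using t(2) cgenideal_eq_genideal[OF t(1)] genideal_zero by simp
    then have "field R" unfolding field_iff_no_nonunit by (metis DiffI singletonD)
    then show False using dvr unfolding DVR_def by simp
  qed
  have prime: "x \<in> nonunits \<or> y \<in> nonunits"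
    if "x \<in> carrier R" "y \<in> carrier R" "x \<otimes> y \<in> nonunits" for x y
    using that Units_m_closed by (metis DiffD2 DiffI)
  have pow: "add_pow ?Q (n::nat) \<one>\<^bsub>?Q\<^esub> = nonunits +> add_pow R n \<one>" for n
  proof (induction n)
    case 0
    show ?case by (simp add: add_pow_def FactRing_def nat_pow_def a_rcos_zero[OF m m.zero_closed])
  next
    case (Suc n)
    have "add_pow ?Q (Suc n) \<one>\<^bsub>?Q\<^esub> = add_pow ?Q n \<one>\<^bsub>?Q\<^esub> \<oplus>\<^bsub>?Q\<^esub> \<one>\<^bsub>?Q\<^esub>"
      by (simp add: add_pow_def nat_pow_def)
    also have "\<dots> = nonunits +> (add_pow R n \<one> \<oplus> \<one>)"
      unfolding Suc by (simp add: FactRing_def m.a_rcos_sum)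
    finally show ?case by simp
  qed
  assume "\<not> char_zero_ring ?Q"
  then obtain n :: nat where n: "n > 0" "add_pow ?Q n \<one>\<^bsub>?Q\<^esub> = \<zero>\<^bsub>?Q\<^esub>"
    unfolding char_zero_ring_def by metis
  have "nonunits +> add_pow R n \<one> = nonunits" using n(2) unfolding pow by (simp add: FactRing_def)
  then have "add_pow R n \<one> \<in> nonunits" using m.rcos_const_imp_mem[of "add_pow R n \<one>"] by simp
  \<comment> \<open>Strong induction: when a prime factor is split off, either it or the smaller
    cofactor is a nonunit.\<close>
  then have "\<exists>p::nat. Factorial_Ring.prime p \<and> add_pow R p \<one> \<in> nonunits" using n(1)
  proof (induction n rule: less_induct)
    case (less n)
    have "\<one> \<notin> nonunits" by simp
    then have "n \<noteq> 1" using less.prems(1) by (metis add.nat_pow_eone one_closed)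
    then obtain p where p: "Factorial_Ring.prime p" "p dvd n" using prime_factor_nat by metis
    then obtain k where k: "n = p * k" by (elim dvdE)
    have "add_pow R p \<one> \<otimes> add_pow R k \<one> = add_pow R p (add_pow R k \<one>)"
      by (simp add: add_pow_ldistr)
    also have "\<dots> = add_pow R n \<one>" unfolding k mult.commute[of p k]
      by (rule add.nat_pow_pow) simp
    finally have "add_pow R n \<one> = add_pow R p \<one> \<otimes> add_pow R k \<one>" by (rule sym)
    then have or: "add_pow R p \<one> \<in> nonunits \<or> add_pow R k \<one> \<in> nonunits"
      using prime[of "add_pow R p \<one>" "add_pow R k \<one>"] less.prems(1) by (simp only: add.nat_pow_closed one_closed)
    have k': "k < n" "k > 0" using less.prems(2) k prime_ge_2_nat[OF p(1)] by auto
    from or show ?case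
    proof
      assume "add_pow R p \<one> \<in> nonunits"
      then show ?thesis using p(1) by (intro exI[of _ p] conjI)
    qed (rule less.IH[OF k'(1) _ k'(2)])
  qed
  then obtain p :: nat where p: "Factorial_Ring.prime p" "add_pow R p \<one> \<in> nonunits" by (elim exE conjE)
  interpret residue_char_p R t p
  proof
    show "t divides x \<or> t divides y" if "x \<in> carrier R" "y \<in> carrier R" "t divides x \<otimes> y" for x y
      using prime[OF that(1,2)] that(3) t_iff[OF that(1)] t_iff[OF that(2)] t_iff[OF m_closed[OF that(1,2)]]
      by simp
    show "t divides add_pow R p \<one>" using t_iff p(2) by simp
  qed fact+
  obtain x :: "nat \<Rightarrow> 'a" where x: "range x \<subseteq> carrier R" "\<And>i j. i \<noteq> j \<Longrightarrow> x i \<ominus> x j \<notin> nonunits"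
    using infinite_index_sequence[OF ideal.axioms(1)[OF m] inf] by metis
  have "x i \<in> carrier R" for i using x(1) by auto
  then show False using not_dp_minimal[of x] x(2) t_iff dp by simp
qed

subsection \<open>The complete integral closure\<close>

lemma (in domain) divides_cancel:
  assumes "x \<in> carrier R" "x \<noteq> \<zero>" "a \<in> carrier R" "b \<in> carrier R" "x \<otimes> a divides x \<otimes> b"
  shows "a divides b"
proof -
  obtain s where s: "x \<otimes> b = x \<otimes> a \<otimes> s" "s \<in> carrier R" using assms(5) by (rule dividesE)
  then have "b = a \<otimes> s" using m_lcancel[OF assms(2,1,4), of "a \<otimes> s"] assms(1,3) m_assoc by simp
  then show ?thesis using s(2) by (rule dividesI[rotated])
qed

lemma (in cring) divides_mult_both:
  assumes "a \<in> carrier R" "c \<in> carrier R" "a divides b" "c divides e"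
  shows "a \<otimes> c divides b \<otimes> e"
proof -
  obtain s where s: "b = a \<otimes> s" "s \<in> carrier R" using assms(3) by (rule dividesE)
  obtain t where t: "e = c \<otimes> t" "t \<in> carrier R" using assms(4) by (rule dividesE)
  have "b \<otimes> e = (a \<otimes> c) \<otimes> (s \<otimes> t)" using assms(1,2) s t by (simp add: m_ac)
  then show ?thesis using s t by (intro dividesI[of "s \<otimes> t"]) simp_all
qed

lemma (in noetherian_domain) unit_if_powers_divide:
  assumes "y \<in> carrier R" "e \<in> carrier R" "e \<noteq> \<zero>" "\<And>n::nat. y [^] n divides e"
  shows "y \<in> Units R"
  using nonunit_powers_not_dividing[OF assms(1) _ assms(2,3)] assms(4) by metis

text \<open>\<open>almost_integral a b\<close> expresses that the fraction \<open>a / b\<close> is almost integral over \<open>R\<close>.\<close>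

definition (in cring) almost_integral :: "'a \<Rightarrow> 'a \<Rightarrow> bool" where
  "almost_integral a b \<longleftrightarrow>
     (\<exists>e\<in>carrier R. e \<noteq> \<zero> \<and> (\<forall>n::nat. b [^] n divides e \<otimes> a [^] n))"

text \<open>Supplies the parameters of \<open>coset_interpretation\<close>. Representatives outside
  \<open>S\<close> may be dropped: if \<open>x\<close> is in \<open>S\<close> and
  \<open>x - f\<close> is a multiple of \<open>u\<close>, then \<open>f\<close> is in
  \<open>S\<close>.\<close>

lemma (in cring) finite_coset_union:
  assumes S: "additive_subgroup S R" and u: "u \<in> carrier R" "\<forall>y\<in>carrier R. u \<otimes> y \<in> S"
    and fin: "finite_index (PIdl u)"
  obtains q :: nat and s where "\<forall>i<q. s i \<in> carrier R"
    "S = {x. \<exists>i<q. \<exists>y\<in>carrier R. x = u \<otimes> y \<oplus> s i}"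
proof -
  interpret S: additive_subgroup S R by fact
  obtain F where F: "finite F" "F \<subseteq> carrier R" "\<forall>x\<in>carrier R. \<exists>f\<in>F. x \<ominus> f \<in> PIdl u"
    using fin unfolding finite_index_def by (elim exE conjE)
  have "finite (F \<inter> S)" using F(1) by simp
  from finite_imp_nat_seg_image_inj_on[OF this]
  obtain q :: nat and s where s: "F \<inter> S = s ` {i. i < q}" by (elim exE conjE)
  have sS: "s i \<in> F \<inter> S" if "i < q" for i unfolding s using that by (intro imageI) simp
  have sR: "s i \<in> carrier R" if "i < q" for i using sS[OF that] F(2) by blast
  have eq: "S = {x. \<exists>i<q. \<exists>y\<in>carrier R. x = u \<otimes> y \<oplus> s i}"
  proof (rule Set.set_eqI, unfold mem_Collect_eq, rule iffI)
    fix x assume x: "x \<in> S"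
    note xR = subsetD[OF S.a_subset x]
    obtain f where f: "f \<in> F" "x \<ominus> f \<in> PIdl u" using bspec[OF F(3) xR] by (elim bexE)
    have fR: "f \<in> carrier R" using f(1) F(2) by (rule subsetD[rotated])
    obtain y where y: "y \<in> carrier R" "x \<ominus> f = y \<otimes> u" using f(2) unfolding cgenideal_def by auto
    have xf: "x \<ominus> f = u \<otimes> y" using y m_comm u(1) by simp
    have "f = x \<ominus> (x \<ominus> f)" using xR fR by algebra
    then have "f \<in> S" unfolding xf minus_eq[of x "u \<otimes> y"]
      using S.a_closed[OF x S.a_inv_closed[OF bspec[OF u(2) y(1)]]] by simp
    then have "f \<in> s ` {i. i < q}" unfolding s[symmetric] using f(1) by simp
    then obtain i where i: "i < q" "f = s i" by auto
    have "u divides (x \<ominus> s i)" using xf y(1) unfolding i(2) by (rule dividesI[rotated])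
    then have "\<exists>y\<in>carrier R. x = u \<otimes> y \<oplus> s i"
      unfolding mem_coset_iff[OF u(1) xR sR[OF i(1)]] .
    then show "\<exists>i<q. \<exists>y\<in>carrier R. x = u \<otimes> y \<oplus> s i" using i(1) by (intro exI[of _ i] conjI)
  next
    fix x assume "\<exists>i<q. \<exists>y\<in>carrier R. x = u \<otimes> y \<oplus> s i"
    then obtain i y where "i < q" "y \<in> carrier R" "x = u \<otimes> y \<oplus> s i" by (elim exE conjE bexE)
    then show "x \<in> S" using S.a_closed[OF bspec[OF u(2)]] sS by simp
  qed
  show ?thesis by (rule that[OF _ eq]) (simp add: sR)
qed

section \<open>Noetherian domains whose elements are comparable up to a constant\<close>

locale weak_valuation_domain = noetherian_domain R for R :: "'a ring" (structure) +
  fixes c :: 'a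
  assumes c: "c \<in> carrier R" "c \<noteq> \<zero>"
    and weak_val: "\<And>a b. a \<in> carrier R \<Longrightarrow> b \<in> carrier R \<Longrightarrow> b divides c \<otimes> a \<or> a divides c \<otimes> b"
begin

abbreviation d :: 'a where "d \<equiv> c \<otimes> c"

lemma d: "d \<in> carrier R" "d \<noteq> \<zero>" using c integral_iff by simp_all

text \<open>Comparing \<open>c a\<close> with \<open>b\<close> lets \<open>c\<close> cancel in the
  second alternative; the price is the square of \<open>c\<close> in the first.\<close>

lemma weak_val_twice:
  assumes "a \<in> carrier R" "b \<in> carrier R"
  shows "b divides d \<otimes> a \<or> a divides b"
  using weak_val[of "c \<otimes> a" b] assms c divides_cancel[OF c assms] by (auto simp: m_assoc)

text \<open>If instead \<open>b = a s\<close>, all powers of \<open>s\<close> divide a fixed nonzero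
  \<open>e\<close>, so \<open>s\<close> is a unit and \<open>b\<close> divides \<open>a\<close>.
  Thus \<open>d\<close> is a common denominator of all almost integral fractions.\<close>

lemma almost_integral_divides:
  assumes "a \<in> carrier R" "b \<in> carrier R" "b \<noteq> \<zero>" "almost_integral a b"
  shows "b divides d \<otimes> a"
  using weak_val_twice[OF assms(1,2)]
proof
  assume "a divides b"
  then obtain s where s: "b = a \<otimes> s" "s \<in> carrier R" by (rule dividesE)
  obtain e where e: "e \<in> carrier R" "e \<noteq> \<zero>" "\<And>n::nat. b [^] n divides e \<otimes> a [^] n"
    using assms(4) unfolding almost_integral_def by metis
  have a: "a \<noteq> \<zero>" using s assms(3) by force
  have "s [^] n divides e" for n :: nat
  proof (rule divides_cancel)
    show "a [^] n \<otimes> s [^] n divides a [^] n \<otimes> e"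
      using e(3)[of n] s assms(1) e(1) m_comm[of e "a [^] n"] by (simp add: nat_pow_distrib)
  qed (use assms(1) a s e nat_pow_nonzero in simp_all)
  then have "s \<in> Units R" using unit_if_powers_divide s e by metis
  then have "a = b \<otimes> inv s" using s assms(1) by (simp add: m_assoc)
  then have "b divides a" using \<open>s \<in> Units R\<close> by (intro dividesI[of "inv s"]) simp_all
  then show ?thesis using divides_mult(2) assms d by simp
qed

text \<open>If both fail, then \<open>d\<close> fails as a witness at some exponents
  \<open>n\<close> and \<open>l\<close>, so \<open>b^n = a^n s\<close> and
  \<open>a^l = b^l t\<close>. Comparing powers with exponent \<open>n l\<close> makes
  \<open>s\<close> a unit, against the choice of \<open>n\<close>.\<close>

lemma almost_integral_total:
  assumes "a \<in> carrier R" "b \<in> carrier R"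
  shows "almost_integral a b \<or> almost_integral b a"
proof (rule ccontr)
  assume neg: "\<not> ?thesis"
  obtain n :: nat where n: "\<not> b [^] n divides d \<otimes> a [^] n"
    using neg d unfolding almost_integral_def by metis
  obtain l :: nat where l: "\<not> a [^] l divides d \<otimes> b [^] l"
    using neg d unfolding almost_integral_def by metis
  have cl: "a [^] k \<in> carrier R" "b [^] k \<in> carrier R" for k :: nat using assms by simp_all
  obtain s where s: "b [^] n = a [^] n \<otimes> s" "s \<in> carrier R"
    using weak_val_twice[OF cl(1)[of n] cl(2)[of n]] n by (auto elim: dividesE)
  obtain t where t: "a [^] l = b [^] l \<otimes> t" "t \<in> carrier R"
    using weak_val_twice[OF cl(2)[of l] cl(1)[of l]] l by (auto elim: dividesE)
  have b: "b \<noteq> \<zero>"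
  proof
    assume "b = \<zero>"
    moreover have "n \<noteq> 0" using n d by (intro notI) (auto intro: dividesI[of d])
    ultimately have "a [^] n \<otimes> s = \<zero>" using s by (simp add: nat_pow_zero)
    moreover have "a [^] l divides d \<otimes> b [^] l" if "l \<noteq> 0"
      using \<open>b = \<zero>\<close> that d cl by (intro dividesI[of \<zero>]) (simp_all add: nat_pow_zero)
    moreover have "l \<noteq> 0" using l d by (intro notI) (auto intro: dividesI[of d])
    ultimately show False using l by simp
  qed
  have "b [^] (n * l) = (a [^] n \<otimes> s) [^] l" using s assms by (simp add: nat_pow_pow[symmetric])
  also have "\<dots> = (a [^] l) [^] n \<otimes> s [^] l"
    using s assms by (simp add: nat_pow_distrib nat_pow_pow mult.commute)
  also have "\<dots> = b [^] (n * l) \<otimes> (t [^] n \<otimes> s [^] l)"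
    using s t assms by (simp add: nat_pow_distrib nat_pow_pow mult.commute m_assoc)
  finally have "b [^] (n * l) \<otimes> \<one> = b [^] (n * l) \<otimes> (t [^] n \<otimes> s [^] l)" using assms by simp
  then have "t [^] n \<otimes> s [^] l = \<one>"
    using m_lcancel[OF nat_pow_nonzero[OF assms(2) b], of "n * l" \<one> "t [^] n \<otimes> s [^] l"] s t assms
    by simp
  moreover have "l \<noteq> 0" using l d by (intro notI) (auto intro: dividesI[of d])
  then obtain l' where "l = Suc l'" using not0_implies_Suc by metis
  ultimately have "s divides \<one>" using s t by (intro dividesI[of "t [^] n \<otimes> s [^] l'"]) (simp_all add: m_ac)
  then have "s \<in> Units R" using divides_unit s(2) by simp
  then have "a [^] n = b [^] n \<otimes> inv s" unfolding s(1) using s(2) cl by (simp add: m_assoc)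
  then have "b [^] n divides a [^] n" using \<open>s \<in> Units R\<close> by (intro dividesI[of "inv s"]) simp_all
  then show False using n divides_mult(2)[OF cl(2) _ cl(1) d(1)] by metis
qed

text \<open>The complete integral closure of \<open>R\<close> in its fraction field, a valuation ring, multiplied by
  the common denominator \<open>d\<close> of its elements, so that it becomes an ideal of \<open>R\<close>.\<close>

definition W :: "'a set" where "W = {r \<in> carrier R. almost_integral r d}"

lemma W_closed: "r \<in> W \<Longrightarrow> r \<in> carrier R" by (simp add: W_def)

lemma d_in_W: "d \<in> W"
  unfolding W_def almost_integral_def using d by (auto intro!: bexI[of _ \<one>])

lemma W_ideal: "ideal W R"
proof (rule idealI[OF ring_axioms])
  have mult: "x \<otimes> r \<in> W" if r: "r \<in> W" and x: "x \<in> carrier R" for r x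
  proof -
    obtain e where e: "e \<in> carrier R" "e \<noteq> \<zero>" "\<And>n::nat. d [^] n divides e \<otimes> r [^] n"
      using r unfolding W_def almost_integral_def by auto
    have "d [^] n divides e \<otimes> (x \<otimes> r) [^] n" for n :: nat
    proof -
      have "e \<otimes> (x \<otimes> r) [^] n = x [^] n \<otimes> (e \<otimes> r [^] n)"
        using e x W_closed[OF r] by (simp add: nat_pow_distrib m_ac)
      then show ?thesis using divides_mult(2)[OF _ e(3), of n "x [^] n"] e x d W_closed[OF r] by simp
    qed
    then show ?thesis using e x W_closed[OF r] unfolding W_def almost_integral_def by auto
  qed
  then show "x \<otimes> r \<in> W" "r \<otimes> x \<in> W" if "r \<in> W" "x \<in> carrier R" for r x
    using that m_comm[of r x] W_closed by simp_all
  show "subgroup W (add_monoid R)"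
  proof (intro add.subgroupI)
    show "W \<subseteq> carrier R" using W_closed by (rule subsetI)
    show "W \<noteq> {}" using d_in_W by (rule ex_in_conv[THEN iffD1, OF exI])
    show "\<ominus> r \<in> W" if "r \<in> W" for r
      using mult[OF that, of "\<ominus> \<one>"] W_closed[OF that] by (simp add: l_minus)
    fix r s assume rs: "r \<in> W" "s \<in> W"
    note cl = rs[THEN W_closed]
    obtain e where e: "e \<in> carrier R" "e \<noteq> \<zero>" "\<And>n::nat. d [^] n divides e \<otimes> r [^] n"
      using rs(1) unfolding W_def almost_integral_def by auto
    obtain f where f: "f \<in> carrier R" "f \<noteq> \<zero>" "\<And>n::nat. d [^] n divides f \<otimes> s [^] n"
      using rs(2) unfolding W_def almost_integral_def by auto
    \<comment> \<open>The extra powers of \<open>r\<close> and \<open>s\<close> generalise the claim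
      so that one factor \<open>r + s\<close> can be expanded at a time.\<close>
    have "d [^] (n + i + j) divides (e \<otimes> f) \<otimes> ((r \<oplus> s) [^] n \<otimes> (r [^] i \<otimes> s [^] j))" for n i j :: nat
    proof (induction n arbitrary: i j)
      case 0
      have "d [^] i \<otimes> d [^] j divides (e \<otimes> r [^] i) \<otimes> (f \<otimes> s [^] j)"
        by (rule divides_mult_both[OF _ _ e(3) f(3)]) (use d in simp_all)
      moreover have "(e \<otimes> r [^] i) \<otimes> (f \<otimes> s [^] j) = (e \<otimes> f) \<otimes> (r [^] i \<otimes> s [^] j)"
        using e f cl by (simp add: m_ac)
      ultimately show ?case using d cl by (simp add: nat_pow_mult)
    next
      case (Suc n)
      have "(e \<otimes> f) \<otimes> ((r \<oplus> s) [^] Suc n \<otimes> (r [^] i \<otimes> s [^] j)) =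
          (e \<otimes> f) \<otimes> ((r \<oplus> s) [^] n \<otimes> (r [^] Suc i \<otimes> s [^] j)) \<oplus>
          (e \<otimes> f) \<otimes> ((r \<oplus> s) [^] n \<otimes> (r [^] i \<otimes> s [^] Suc j))"
        using e(1) f(1) cl nat_pow_closed[OF cl(1), of i] nat_pow_closed[OF cl(2), of j]
          nat_pow_closed[OF a_closed[OF cl], of n] unfolding nat_pow_Suc by algebra
      then show ?case using divides_add[OF _ Suc[of "Suc i" j]] Suc[of i "Suc j"] d by simp
    qed
    from this[of _ 0 0] have "d [^] n divides (e \<otimes> f) \<otimes> (r \<oplus> s) [^] n" for n :: nat
      using cl by simp
    moreover have "e \<otimes> f \<noteq> \<zero>" using e f integral_iff by simp
    ultimately show "r \<oplus> s \<in> W" using cl e(1) f(1)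
      unfolding W_def almost_integral_def by (auto intro!: bexI[of _ "e \<otimes> f"])
  qed
qed

text \<open>The fraction \<open>r s / d^2\<close> is almost integral, so \<open>d\<close> is a
  denominator for it. Cancelling gives \<open>d t = r s\<close>, and the same witness shows that
  \<open>t / d\<close> is almost integral.\<close>

lemma W_mult:
  assumes "r \<in> W" "s \<in> W"
  obtains t where "t \<in> W" "d \<otimes> t = r \<otimes> s"
proof -
  note cl = assms[THEN W_closed]
  obtain e where e: "e \<in> carrier R" "e \<noteq> \<zero>" "\<And>n::nat. d [^] n divides e \<otimes> r [^] n"
    using assms(1) unfolding W_def almost_integral_def by auto
  obtain f where f: "f \<in> carrier R" "f \<noteq> \<zero>" "\<And>n::nat. d [^] n divides f \<otimes> s [^] n"
    using assms(2) unfolding W_def almost_integral_def by auto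
  have ef: "e \<otimes> f \<in> carrier R" "e \<otimes> f \<noteq> \<zero>" using e f integral_iff by simp_all
  have dv: "d [^] n \<otimes> d [^] n divides (e \<otimes> f) \<otimes> (r \<otimes> s) [^] n" for n :: nat
  proof -
    have "d [^] n \<otimes> d [^] n divides (e \<otimes> r [^] n) \<otimes> (f \<otimes> s [^] n)"
      by (rule divides_mult_both[OF _ _ e(3) f(3)]) (use d in simp_all)
    moreover have "(e \<otimes> r [^] n) \<otimes> (f \<otimes> s [^] n) = (e \<otimes> f) \<otimes> (r \<otimes> s) [^] n"
      using e f cl by (simp add: m_ac nat_pow_distrib)
    ultimately show ?thesis by simp
  qed
  have "(d \<otimes> d) [^] n divides (e \<otimes> f) \<otimes> (r \<otimes> s) [^] n" for n :: nat
    using dv[of n] nat_pow_distrib[OF d(1) d(1), of n] by simp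
  then have "almost_integral (r \<otimes> s) (d \<otimes> d)"
    unfolding almost_integral_def using ef by (intro bexI[of _ "e \<otimes> f"]) simp_all
  then have "d \<otimes> d divides d \<otimes> (r \<otimes> s)"
    using almost_integral_divides[of "r \<otimes> s" "d \<otimes> d"] cl d integral_iff by simp
  then have "d divides r \<otimes> s" using divides_cancel[OF d d(1)] cl by simp
  then obtain t where t: "r \<otimes> s = d \<otimes> t" "t \<in> carrier R" by (rule dividesE)
  have "d [^] n divides (e \<otimes> f) \<otimes> t [^] n" for n :: nat
  proof (rule divides_cancel)
    show "d [^] n \<otimes> d [^] n divides d [^] n \<otimes> ((e \<otimes> f) \<otimes> t [^] n)"
      using dv[of n] t d ef m_lcomm[of "d [^] n" "e \<otimes> f" "t [^] n"] by (simp add: nat_pow_distrib)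
  qed (use d t ef nat_pow_nonzero in simp_all)
  then have "t \<in> W" using t(2) ef unfolding W_def almost_integral_def by auto
  then show ?thesis using that t(1) by simp
qed

text \<open>An element \<open>w\<close> stands for the fraction \<open>w / d\<close>, so the unit is
  \<open>d\<close> and products are divided by \<open>d\<close>; cancellation in \<open>R\<close>
  makes the described \<open>z\<close> unique. This realises the closure on the type of
  \<open>R\<close>.\<close>

definition A :: "'a ring" where
  "A = \<lparr>carrier = W, monoid.mult = \<lambda>x y. THE z. z \<in> carrier R \<and> d \<otimes> z = x \<otimes> y, one = d,
        ring.zero = \<zero>, ring.add = (\<oplus>)\<rparr>"

section \<open>Ring structure of the complete integral closure\<close>

lemma A_simps [simp]: "carrier A = W" "\<one>\<^bsub>A\<^esub> = d" "\<zero>\<^bsub>A\<^esub> = \<zero>" "x \<oplus>\<^bsub>A\<^esub> y = x \<oplus> y"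
  by (simp_all add: A_def)

lemma d_cancel: "x \<in> carrier R \<Longrightarrow> y \<in> carrier R \<Longrightarrow> d \<otimes> x = d \<otimes> y \<Longrightarrow> x = y"
  using m_lcancel[OF d(2,1)] by simp

lemma A_mult:
  assumes "x \<in> W" "y \<in> W"
  shows "x \<otimes>\<^bsub>A\<^esub> y \<in> W" "d \<otimes> (x \<otimes>\<^bsub>A\<^esub> y) = x \<otimes> y"
proof -
  obtain t where t: "t \<in> W" "d \<otimes> t = x \<otimes> y" using W_mult assms by metis
  have "x \<otimes>\<^bsub>A\<^esub> y = t" unfolding A_def monoid.simps
    by (rule the_equality) (use t W_closed[OF t(1)] d_cancel in simp_all)
  then show "x \<otimes>\<^bsub>A\<^esub> y \<in> W" "d \<otimes> (x \<otimes>\<^bsub>A\<^esub> y) = x \<otimes> y" using t by simp_all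
qed

lemma A_multI:
  assumes "x \<in> W" "y \<in> W" "z \<in> carrier R" "d \<otimes> z = x \<otimes> y"
  shows "x \<otimes>\<^bsub>A\<^esub> y = z"
  using A_mult[OF assms(1,2)] assms(3,4) d_cancel W_closed by metis

sublocale W: ideal W R by (rule W_ideal)

lemma domain_A: "domain A"
proof (intro domain.intro cringI domain_axioms.intro)
  show "abelian_group A"
  proof (rule abelian_groupI)
    show "\<exists>y\<in>carrier A. y \<oplus>\<^bsub>A\<^esub> x = \<zero>\<^bsub>A\<^esub>" if "x \<in> carrier A" for x
      using that W.a_inv_closed[of x] W_closed[of x] by (intro bexI[of _ "\<ominus> x"]) (simp_all add: l_neg)
  qed (use W_closed in \<open>simp_all add: a_ac\<close>)
  show "comm_monoid A"
  proof (rule comm_monoidI)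
    fix x y z assume "x \<in> carrier A" "y \<in> carrier A" "z \<in> carrier A"
    then have xyz: "x \<in> W" "y \<in> W" "z \<in> W" by simp_all
    note cl = xyz[THEN W_closed]
    show "x \<otimes>\<^bsub>A\<^esub> y \<otimes>\<^bsub>A\<^esub> z = x \<otimes>\<^bsub>A\<^esub> (y \<otimes>\<^bsub>A\<^esub> z)"
    proof (rule A_multI[OF A_mult(1)[OF xyz(1,2)] xyz(3)])
      let ?p = "x \<otimes>\<^bsub>A\<^esub> y" and ?q = "y \<otimes>\<^bsub>A\<^esub> z"
      have m: "?p \<in> W" "?q \<in> W" "x \<otimes>\<^bsub>A\<^esub> ?q \<in> W" using A_mult(1) xyz by simp_all
      note cl' = m[THEN W_closed]
      show "x \<otimes>\<^bsub>A\<^esub> ?q \<in> carrier R" by (rule cl')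
      \<comment> \<open>Together with the enclosing rule this multiplies by \<open>d\<close> twice,
        after which both sides are products in \<open>R\<close>.\<close>
      show "d \<otimes> (x \<otimes>\<^bsub>A\<^esub> ?q) = ?p \<otimes> z"
      proof (rule d_cancel)
        have "d \<otimes> (d \<otimes> (x \<otimes>\<^bsub>A\<^esub> ?q)) = x \<otimes> (d \<otimes> ?q)"
          unfolding A_mult(2)[OF xyz(1) m(2)] using m_lcomm d(1) cl(1) cl'(2) by simp
        also have "\<dots> = d \<otimes> ?p \<otimes> z"
          unfolding A_mult(2)[OF xyz(2,3)] A_mult(2)[OF xyz(1,2)] using m_assoc cl by simp
        finally show "d \<otimes> (d \<otimes> (x \<otimes>\<^bsub>A\<^esub> ?q)) = d \<otimes> (?p \<otimes> z)" using m_assoc d(1) cl cl' by simp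
      qed (use d cl cl' in simp_all)
    qed
    show "\<one>\<^bsub>A\<^esub> \<otimes>\<^bsub>A\<^esub> x = x" using A_multI[OF d_in_W xyz(1) cl(1)] by simp
    show "x \<otimes>\<^bsub>A\<^esub> y = y \<otimes>\<^bsub>A\<^esub> x"
      using A_multI[OF xyz(1,2) W_closed[OF A_mult(1)[OF xyz(2,1)]]] A_mult(2)[OF xyz(2,1)] m_comm cl by simp
    show "x \<otimes>\<^bsub>A\<^esub> y \<in> carrier A" using A_mult(1) xyz by simp
  qed (simp add: d_in_W)
  fix x y z assume "x \<in> carrier A" "y \<in> carrier A"
  then have xy: "x \<in> W" "y \<in> W" by simp_all
  note cl = xy[THEN W_closed]
  show "x = \<zero>\<^bsub>A\<^esub> \<or> y = \<zero>\<^bsub>A\<^esub>" if "x \<otimes>\<^bsub>A\<^esub> y = \<zero>\<^bsub>A\<^esub>"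
    using A_mult(2)[OF xy] that integral_iff[OF cl] d(1) by simp
  assume "z \<in> carrier A"
  then have z: "z \<in> W" by simp
  show "(x \<oplus>\<^bsub>A\<^esub> y) \<otimes>\<^bsub>A\<^esub> z = x \<otimes>\<^bsub>A\<^esub> z \<oplus>\<^bsub>A\<^esub> y \<otimes>\<^bsub>A\<^esub> z"
    unfolding A_simps
  proof (rule A_multI[OF W.a_closed[OF xy] z])
    have m: "x \<otimes>\<^bsub>A\<^esub> z \<in> carrier R" "y \<otimes>\<^bsub>A\<^esub> z \<in> carrier R"
      using A_mult(1) xy z W_closed by simp_all
    then show "x \<otimes>\<^bsub>A\<^esub> z \<oplus> y \<otimes>\<^bsub>A\<^esub> z \<in> carrier R" by simp
    show "d \<otimes> (x \<otimes>\<^bsub>A\<^esub> z \<oplus> y \<otimes>\<^bsub>A\<^esub> z) = (x \<oplus> y) \<otimes> z"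
      unfolding r_distr[OF m d(1)] A_mult(2)[OF xy(1) z] A_mult(2)[OF xy(2) z]
      using l_distr cl W_closed[OF z] by simp
  qed
qed (use d in simp_all)

sublocale A: "domain" A by (rule domain_A)

text \<open>Multiplying by \<open>x\<close> in \<open>R\<close> agrees with multiplying by
  \<open>d x\<close> in \<open>A\<close>. Hence \<open>A\<close> inherits the chain condition on
  ideals from \<open>R\<close>.\<close>

lemma A_ideal_imp_ideal:
  assumes "ideal I A"
  shows "ideal I R"
proof (rule idealI[OF ring_axioms])
  interpret I: ideal I A by fact
  have sub: "I \<subseteq> W" using I.a_subset by simp
  have mult: "x \<otimes> w \<in> I" if w: "w \<in> I" and x: "x \<in> carrier R" for w x
  proof -
    have wW: "w \<in> W" using w sub by (rule subsetD[rotated])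
    have "d \<otimes> x \<in> W" using W.I_r_closed[OF d_in_W x] .
    moreover have "d \<otimes> (x \<otimes> w) = d \<otimes> x \<otimes> w" using m_assoc d(1) x W_closed[OF wW] by simp
    ultimately have "(d \<otimes> x) \<otimes>\<^bsub>A\<^esub> w = x \<otimes> w"
      using A_multI[OF _ wW] W_closed[OF wW] x by simp
    moreover have "(d \<otimes> x) \<otimes>\<^bsub>A\<^esub> w \<in> I" using I.I_l_closed[OF w] \<open>d \<otimes> x \<in> W\<close> by simp
    ultimately show ?thesis by simp
  qed
  show "x \<otimes> w \<in> I" "w \<otimes> x \<in> I" if "w \<in> I" "x \<in> carrier R" for w x
    using mult[OF that] m_comm[OF W_closed[OF subsetD[OF sub that(1)]] that(2)] by simp_all
  show "subgroup I (add_monoid R)"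
  proof (intro add.subgroupI)
    show "I \<subseteq> carrier R" using sub W.a_subset by (rule subset_trans)
    show "I \<noteq> {}" using I.zero_closed by (rule ex_in_conv[THEN iffD1, OF exI])
    fix w v assume wv: "w \<in> I" "v \<in> I"
    show "w \<oplus> v \<in> I" using I.a_closed[OF wv] by simp
    have "w \<in> carrier R" using wv(1) sub W_closed by (metis subsetD)
    then show "\<ominus> w \<in> I" using mult[OF wv(1), of "\<ominus> \<one>"] by (simp add: l_minus)
  qed
qed

lemma A_minus: "x \<in> W \<Longrightarrow> y \<in> W \<Longrightarrow> x \<ominus>\<^bsub>A\<^esub> y = x \<ominus> y"
proof -
  assume xy: "x \<in> W" "y \<in> W"
  note cl = xy[THEN W_closed]
  have n: "\<ominus> y \<in> W" using W.a_inv_closed[OF xy(2)] by simp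
  have "\<ominus>\<^bsub>A\<^esub> y = \<ominus> y" using n xy cl by (intro A.minus_equality) (simp_all add: l_neg)
  then show ?thesis by (simp add: A.minus_eq minus_eq)
qed

lemma noetherian_domain_A: "noetherian_domain A"
proof (rule noetherian_domain.intro)
  show "noetherian_ring A"
  proof (rule A.trivial_ideal_chain_imp_noetherian)
    fix C assume C: "C \<noteq> {}" "subset.chain {I. ideal I A} C"
    then have "subset.chain {I. ideal I R} C"
      using A_ideal_imp_ideal by (auto simp: subset_chain_def)
    then show "\<Union>C \<in> C" by (rule ideal_chain_is_trivial[OF C(1)])
  qed
qed (rule domain_A)

sublocale A: noetherian_domain A by (rule noetherian_domain_A)

text \<open>With \<open>d a = b w\<close>, the fraction \<open>w / d\<close> equals
  \<open>a / b\<close>; it is therefore almost integral and serves as the quotient in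
  \<open>A\<close>.\<close>

lemma A_divides:
  assumes "a \<in> W" "b \<in> W" "b \<noteq> \<zero>" "almost_integral a b"
  shows "b divides\<^bsub>A\<^esub> a"
proof -
  note cl = assms(1,2)[THEN W_closed]
  obtain w where w: "d \<otimes> a = b \<otimes> w" "w \<in> carrier R"
    using almost_integral_divides[OF cl assms(3,4)] by (rule dividesE)
  obtain e where e: "e \<in> carrier R" "e \<noteq> \<zero>" "\<And>n::nat. b [^] n divides e \<otimes> a [^] n"
    using assms(4) unfolding almost_integral_def by metis
  have "d [^] n divides e \<otimes> w [^] n" for n :: nat
  proof (rule divides_cancel)
    have "b [^] n \<otimes> (e \<otimes> w [^] n) = e \<otimes> (b \<otimes> w) [^] n"
      using cl w e by (simp add: nat_pow_distrib m_lcomm)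
    also have "\<dots> = d [^] n \<otimes> (e \<otimes> a [^] n)"
      unfolding w(1)[symmetric] nat_pow_distrib[OF d(1) cl(1)]
      by (rule m_lcomm) (use cl d e in simp_all)
    moreover have "d [^] n \<otimes> b [^] n divides d [^] n \<otimes> (e \<otimes> a [^] n)"
      using e(3)[of n] d cl by (intro divides_mult_both divides_refl) simp_all
    ultimately show "b [^] n \<otimes> d [^] n divides b [^] n \<otimes> (e \<otimes> w [^] n)"
      using m_comm[of "b [^] n" "d [^] n"] d cl by simp
  qed (use cl d e w assms(3) nat_pow_nonzero in simp_all)
  then have wW: "w \<in> W" using w(2) e unfolding W_def almost_integral_def by auto
  have "b \<otimes>\<^bsub>A\<^esub> w = a" by (rule A_multI[OF assms(2) wW cl(1) w(1)])
  then show ?thesis using wW by (intro dividesI[of w]) simp_all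
qed

section \<open>The complete integral closure is a discrete valuation ring\<close>

lemma A_valuation:
  assumes "a \<in> carrier A" "b \<in> carrier A"
  shows "a divides\<^bsub>A\<^esub> b \<or> b divides\<^bsub>A\<^esub> a"
proof (cases "a = \<zero> \<or> b = \<zero>")
  case True
  moreover have "x divides\<^bsub>A\<^esub> \<zero>" if "x \<in> W" for x
    using that by (intro dividesI[of \<zero>]) (use A.r_null[of x] in simp_all)
  ultimately show ?thesis using assms by auto
next
  case False
  have W: "a \<in> W" "b \<in> W" using assms by simp_all
  have nz: "a \<noteq> \<zero>" "b \<noteq> \<zero>" using False by simp_all
  from almost_integral_total[OF W_closed[OF W(1)] W_closed[OF W(2)]] show ?thesis
    by (rule disjE) (rule disjI2, erule A_divides[OF W nz(2)], rule disjI1, erule A_divides[OF W(2,1) nz(1)])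
qed

text \<open>If \<open>w / d\<close> inverted \<open>y\<close> and \<open>e\<close> witnessed its
  almost integrality, all powers of \<open>y\<close> would divide \<open>e\<close>, making
  \<open>y\<close> a unit of \<open>R\<close>.\<close>

lemma A_nonunit:
  assumes y: "y \<in> nonunits" "y \<noteq> \<zero>"
  shows "d \<otimes> y \<in> carrier A - Units A" "d \<otimes> y \<noteq> \<zero>"
proof -
  have y': "y \<in> carrier R" using y(1) by simp
  show "d \<otimes> y \<noteq> \<zero>" using d y' y(2) integral_iff by simp
  have dy: "d \<otimes> y \<in> W" using W.I_r_closed[OF d_in_W y'] .
  have "d \<otimes> y \<notin> Units A"
  proof
    assume u: "d \<otimes> y \<in> Units A"
    let ?w = "inv\<^bsub>A\<^esub> (d \<otimes> y)"
    have w: "?w \<in> W" using A.Units_inv_closed[OF u] by simp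
    note w' = W_closed[OF w]
    have "(d \<otimes> y) \<otimes>\<^bsub>A\<^esub> ?w = d" using A.Units_r_inv[OF u] by simp
    then have "d \<otimes> d = d \<otimes> y \<otimes> ?w" using A_mult(2)[OF dy w] by simp
    then have yw: "d = y \<otimes> ?w" using d_cancel[of d "y \<otimes> ?w"] d y' w' m_assoc by simp
    obtain e where e: "e \<in> carrier R" "e \<noteq> \<zero>" "\<And>n::nat. d [^] n divides e \<otimes> ?w [^] n"
      using w unfolding W_def almost_integral_def by auto
    have "y [^] n divides e" for n :: nat
    proof (rule divides_cancel)
      have "y [^] n \<otimes> d [^] n divides y [^] n \<otimes> (e \<otimes> ?w [^] n)"
        using e(3)[of n] d y' w' e(1) by (intro divides_mult_both divides_refl) simp_all
      also have "y [^] n \<otimes> (e \<otimes> ?w [^] n) = (y \<otimes> ?w) [^] n \<otimes> e"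
        using y' w' e(1) by (simp add: nat_pow_distrib m_ac)
      finally show "d [^] n \<otimes> y [^] n divides d [^] n \<otimes> e"
        unfolding yw[symmetric] using m_comm[of "d [^] n" "y [^] n"] d y' by simp
    qed (use d e y' nat_pow_nonzero in simp_all)
    then have "y \<in> Units R" using unit_if_powers_divide y' e by metis
    then show False using y(1) by simp
  qed
  then show "d \<otimes> y \<in> carrier A - Units A" using dy by simp
qed

lemma DVR_A:
  assumes "\<not> field R"
  shows "DVR A"
proof -
  obtain y where y: "y \<in> nonunits" "y \<noteq> \<zero>" using assms unfolding field_iff_no_nonunit by auto
  have "\<not> field A" using A_nonunit[OF y] unfolding A.field_iff_no_nonunit by auto
  then show ?thesis using A.valuation_DVR A_valuation by simp
qed

text \<open>Multiplication by \<open>d\<close> represents the inclusion of \<open>R\<close> in its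
  complete integral closure.\<close>

lemma mult_d_hom: "(\<otimes>) d \<in> ring_hom R A"
proof (rule ring_hom_memI)
  fix x y assume xy: "x \<in> carrier R" "y \<in> carrier R"
  show dx: "d \<otimes> x \<in> carrier A" using W.I_r_closed[OF d_in_W xy(1)] by simp
  have dy: "d \<otimes> y \<in> carrier A" using W.I_r_closed[OF d_in_W xy(2)] by simp
  show "d \<otimes> (x \<otimes> y) = (d \<otimes> x) \<otimes>\<^bsub>A\<^esub> (d \<otimes> y)"
    by (rule A_multI[symmetric]) (use dx dy xy d in \<open>simp_all add: m_ac\<close>)
  show "d \<otimes> (x \<oplus> y) = (d \<otimes> x) \<oplus>\<^bsub>A\<^esub> (d \<otimes> y)" using r_distr xy d by simp
qed (use d in simp)

lemma mult_d_inj: "inj_on ((\<otimes>) d) (carrier R)"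
  by (rule inj_onI) (rule d_cancel)

text \<open>The nonunits form the only possible nonzero prime: for nonzero \<open>e\<close> in a
  prime \<open>P\<close> and a nonunit \<open>z\<close>, some \<open>z^k\<close> does not divide
  \<open>c^2 e\<close>, so \<open>c e\<close> divides \<open>c z^k\<close> and \<open>z^k\<close>
  lies in \<open>P\<close>.\<close>

lemma finite_index_ideal:
  assumes loc: is_local and fin: "finite_index nonunits" and I: "ideal I R" "I \<noteq> {\<zero>}"
  shows "finite_index I"
proof (rule finite_index_nonzero_ideal[OF _ I])
  fix P assume P: "primeideal P R" "P \<noteq> {\<zero>}"
  interpret P: primeideal P R by fact
  obtain e where e: "e \<in> P" "e \<noteq> \<zero>" using P(2) P.zero_closed by auto
  note e' = P.Icarr[OF e(1)]
  have "z \<in> P" if z: "z \<in> nonunits" for z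
  proof -
    have z': "z \<in> carrier R" using z by simp
    have ce: "c \<otimes> (c \<otimes> e) \<in> carrier R" "c \<otimes> (c \<otimes> e) \<noteq> \<zero>" using c e(2) e' integral_iff by simp_all
    obtain k :: nat where k: "\<not> z [^] k divides c \<otimes> (c \<otimes> e)"
      using nonunit_powers_not_dividing[OF z' _ ce] z by auto
    then have "c \<otimes> e divides c \<otimes> z [^] k"
      using weak_val[of "z [^] k" "c \<otimes> e"] c e' z' by simp
    then have "e divides z [^] k" using divides_cancel[OF c e'] z' by simp
    then have zk: "z [^] k \<in> P" by (rule divides_closed_ideal[OF P.is_ideal e(1)])
    have "z [^] n \<in> P \<Longrightarrow> z \<in> P" for n :: nat
    proof (induction n)
      case 0
      then show ?case using P.one_imp_carrier P.I_notcarr by simp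
    next
      case (Suc n)
      then show ?case using P.I_prime[of "z [^] n" z] z' by auto
    qed
    then show ?thesis using zk by simp
  qed
  then have "nonunits \<subseteq> P" by (rule subsetI)
  moreover have "P \<subseteq> nonunits" using proper_ideal_subset_nonunits P.is_ideal P.I_notcarr by simp
  ultimately have "P = nonunits" by (rule subset_antisym[rotated])
  then show "finite_index P" using fin by simp
qed

lemma A_finite_index:
  assumes loc: is_local and fin: "finite_index nonunits" and I: "ideal I R" "I \<noteq> {\<zero>}" "I \<subseteq> W"
  obtains F where "finite F" "F \<subseteq> W" "\<And>x. x \<in> W \<Longrightarrow> \<exists>f\<in>F. x \<ominus> f \<in> I"
proof -
  interpret I: ideal I R by fact
  obtain F where F: "finite F" "F \<subseteq> carrier R" "\<forall>x\<in>carrier R. \<exists>f\<in>F. x \<ominus> f \<in> I"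
    using finite_index_ideal[OF loc fin I(1,2)] unfolding finite_index_def by (elim exE conjE)
  have "\<exists>f\<in>F \<inter> W. x \<ominus> f \<in> I" if x: "x \<in> W" for x
  proof -
    obtain f where f: "f \<in> F" "x \<ominus> f \<in> I" using bspec[OF F(3) W_closed[OF x]] by (elim bexE)
    have cl: "f \<in> carrier R" "x \<in> carrier R" using f(1) F(2) W_closed[OF x] by auto
    have "x \<ominus> (x \<ominus> f) \<in> W"
      unfolding minus_eq[of x "x \<ominus> f"] using W.a_closed[OF x W.a_inv_closed] f(2) I(3) by auto
    moreover have "x \<ominus> (x \<ominus> f) = f" using cl by algebra
    ultimately show ?thesis using f by (intro bexI[of _ f]) simp_all
  qed
  then show ?thesis using that[of "F \<inter> W"] F(1) by simp
qed

lemma A_finite_rcosets: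
  assumes loc: is_local and fin: "finite_index nonunits"
    and "additive_subgroup I A" and I: "ideal I R" "I \<noteq> {\<zero>}" "I \<subseteq> W"
  shows "finite (a_rcosets\<^bsub>A\<^esub> I)"
proof -
  obtain F where F: "finite F" "F \<subseteq> W" "\<And>x. x \<in> W \<Longrightarrow> \<exists>f\<in>F. x \<ominus> f \<in> I"
    using A_finite_index[OF loc fin I] by metis
  have "\<exists>f\<in>F. x \<ominus>\<^bsub>A\<^esub> f \<in> I" if "x \<in> W" for x
    using F(3)[OF that] A_minus[OF that subsetD[OF F(2)]] by (metis)
  then have "A.finite_index I" unfolding A.finite_index_def using F(1,2)
    by (intro exI[of _ F]) simp
  then show ?thesis using A.finite_index_iff[OF assms(3)] by simp
qed

text \<open>Inside \<open>R\<close> the image is the principal ideal of \<open>d\<close>, a nonzero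
  ideal and therefore of finite index.\<close>

lemma finite_index_subring_A:
  assumes loc: is_local and fin: "finite_index nonunits"
  shows "finite_index_subring ((\<otimes>) d ` carrier R) A"
proof -
  let ?S = "(\<otimes>) d ` carrier R"
  interpret h: ring_hom_ring R A "(\<otimes>) d"
    by (intro ring_hom_ringI2 ring_axioms A.ring_axioms mult_d_hom)
  have S: "subring ?S A" by (rule h.img_is_subring[OF carrier_is_subring])
  have P: "?S = PIdl d" unfolding cgenideal_def using m_comm d by (auto simp: image_def)
  have "?S \<noteq> {\<zero>}" using d by (metis imageI one_closed r_one singletonD)
  moreover have "?S \<subseteq> W" using W.I_r_closed[OF d_in_W] by auto
  moreover have "ideal ?S R" unfolding P by (rule cgenideal_ideal[OF d(1)])
  moreover have "additive_subgroup ?S A"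
    using S by (intro additive_subgroup.intro) (rule subring.axioms(1))
  ultimately have "finite (a_rcosets\<^bsub>A\<^esub> ?S)" using A_finite_rcosets[OF loc fin] by simp
  then show ?thesis using S unfolding finite_index_subring_def by simp
qed

text \<open>The maximal ideal of \<open>A\<close> is also a nonzero ideal of \<open>R\<close>, hence
  of finite index.\<close>

lemma finite_residue_field_A:
  assumes loc: is_local and fin: "finite_index nonunits" and nf: "\<not> field R"
  shows "finite (carrier (residue_field A))"
proof -
  have A_loc: A.is_local using A.valuation_local A_valuation by simp
  let ?M = "carrier A - Units A"
  have M: "ideal ?M A" by (rule A.nonunits_ideal[OF A_loc])
  obtain y where y: "y \<in> nonunits" "y \<noteq> \<zero>" using nf unfolding field_iff_no_nonunit by auto
  have "?M \<noteq> {\<zero>}" using A_nonunit[OF y] by (metis singletonD)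
  then have "finite (a_rcosets\<^bsub>A\<^esub> ?M)"
    using A_finite_rcosets[OF loc fin ideal.axioms(1)[OF M] A_ideal_imp_ideal[OF M]] by auto
  then show ?thesis unfolding residue_field_def A.the_maximalideal[OF A_loc]
    by (simp add: FactRing_def)
qed

lemma dp_minimal_A:
  assumes loc: is_local and fin: "finite_index nonunits" and dp: "dp_minimal R"
  shows "dp_minimal A"
proof -
  have "PIdl d \<noteq> {\<zero>}" using cgenideal_self[OF d(1)] d(2) by auto
  then have fin_d: "finite_index (PIdl d)"
    by (rule finite_index_ideal[OF loc fin cgenideal_ideal[OF d(1)]])
  have dW: "\<forall>y\<in>carrier R. d \<otimes> y \<in> W" using W.I_r_closed[OF d_in_W] by (rule ballI)
  obtain q :: nat and s where s: "\<forall>i<q. s i \<in> carrier R"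
      "W = {x. \<exists>i<q. \<exists>y\<in>carrier R. x = d \<otimes> y \<oplus> s i}"
    by (rule finite_coset_union[OF W.additive_subgroup_axioms d(1) dW fin_d]) (rule that)
  \<comment> \<open>The map is the identity; \<open>d\<close> serves both as the denominator of
    products and as the generator of the ideal whose cosets make up \<open>W\<close>.\<close>
  interpret coset_interpretation A R id d d s q
  proof unfold_locales
    show "id ` carrier A = {x. \<exists>i<q. \<exists>y\<in>carrier R. x = d \<otimes> y \<oplus> s i}"
      unfolding image_id id_apply A_simps by (rule s(2))
    show "s i \<in> carrier R" if "i < q" for i using s(1) that by simp
  qed (use d A_mult(2) in simp_all)
  have "infinite (carrier R)" using dp unfolding dp_minimal_def by simp
  then have "infinite ((\<otimes>) d ` carrier R)" using finite_imageD mult_d_inj by blast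
  moreover have "(\<otimes>) d ` carrier R \<subseteq> carrier A" using W.I_r_closed[OF d_in_W] by auto
  ultimately have "infinite (carrier A)" using finite_subset by metis
  then show ?thesis by (rule dp_minimal_lift[OF dp])
qed

lemma finite_index_in_mixedchar:
  assumes "dp_minimal R" "\<not> field R" "finite_index nonunits"
  shows "\<exists>(A :: 'a ring) h. mixedchar_dp_minimal_DVR A \<and> h \<in> ring_hom R A \<and>
    inj_on h (carrier R) \<and> finite_index_subring (h ` carrier R) A"
proof -
  note loc = dp_minimal_local[OF assms(1)]
  have "mixedchar_dp_minimal_DVR A"
    unfolding mixedchar_dp_minimal_DVR_def
    using DVR_A[OF assms(2)] dp_minimal_A[OF loc assms(3,1)]
      finite_residue_field_A[OF loc assms(3,2)] by simp
  then show ?thesis using mult_d_hom mult_d_inj finite_index_subring_A[OF loc assms(3)]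
    by (intro exI[of _ A] exI[of _ "(\<otimes>) d"] conjI)
qed

end

section \<open>Infinite and finite residue fields\<close>

lemma (in noetherian_domain) dp_minimal_infinite_residue:
  assumes dp: "dp_minimal R" and "\<not> field R" and inf: "\<not> finite_index nonunits"
  shows "equichar_dp_minimal_DVR R"
proof -
  have "DVR R" using valuation_DVR[OF dp_minimal_valuation[OF dp inf] assms(2)] .
  then show ?thesis
    using char_zero_residue[OF dp _ inf] dp the_maximalideal[OF dp_minimal_local[OF dp]]
    unfolding equichar_dp_minimal_DVR_def residue_field_def by simp
qed

lemma noetherian_dp_minimal_cases:
  fixes R :: "'a ring"
  assumes "noetherian_domain R" and dp: "dp_minimal R"
  shows "field R \<or> equichar_dp_minimal_DVR R \<or>
    (\<exists>(A :: 'a ring) h. mixedchar_dp_minimal_DVR A \<and> h \<in> ring_hom R A \<and>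
       inj_on h (carrier R) \<and> finite_index_subring (h ` carrier R) A)"
proof -
  interpret noetherian_domain R by fact
  consider "field R" | "\<not> field R" "\<not> finite_index nonunits" | "\<not> field R" "finite_index nonunits"
    by metis
  then show ?thesis
  proof cases
    case 3
    obtain y where y: "y \<in> nonunits" "y \<noteq> \<zero>\<^bsub>R\<^esub>"
      using 3(1) unfolding field_iff_no_nonunit by auto
    then obtain N :: nat where N: "\<And>a b. a \<in> carrier R \<Longrightarrow> b \<in> carrier R \<Longrightarrow>
        b divides\<^bsub>R\<^esub> y [^]\<^bsub>R\<^esub> N \<otimes>\<^bsub>R\<^esub> a \<or> a divides\<^bsub>R\<^esub> y [^]\<^bsub>R\<^esub> N \<otimes>\<^bsub>R\<^esub> b"
      using dp_minimal_weak_valuation[OF dp] by metis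
    interpret weak_valuation_domain R "y [^]\<^bsub>R\<^esub> N"
      by unfold_locales (use y N nat_pow_nonzero in simp_all)
    show ?thesis using finite_index_in_mixedchar[OF dp 3] by (intro disjI2)
  qed (use dp_minimal_infinite_residue[OF dp] in simp_all)
qed

subsection \<open>Finite-index subrings\<close>

text \<open>Nonzero primes of a principal ideal domain are maximal, so each is the unique maximal
  ideal, whose index is finite because the residue field is.\<close>

lemma finite_index_ideal_mixedchar:
  assumes "mixedchar_dp_minimal_DVR A" "ideal I A" "I \<noteq> {\<zero>\<^bsub>A\<^esub>}"
  shows "ring.finite_index A I"
proof -
  interpret principal_domain A
    using assms(1) unfolding mixedchar_dp_minimal_DVR_def DVR_def by simp
  show ?thesis
  proof (rule finite_index_nonzero_ideal[OF _ assms(2,3)])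
    fix P assume P: "primeideal P A" "P \<noteq> {\<zero>\<^bsub>A\<^esub>}"
    have idl: "ideal P A" using P(1) by (rule primeideal.axioms(1))
    obtain p where p: "p \<in> carrier A" "P = PIdl\<^bsub>A\<^esub> p" using exists_gen[OF idl] by (elim bexE)
    have "p \<noteq> \<zero>\<^bsub>A\<^esub>" using P(2) p cgenideal_eq_genideal[OF p(1)] genideal_zero by auto
    then have "ring_irreducible\<^bsub>A\<^esub> p"
      using P(1) p primeideal_iff_prime[of p] primeness_condition[of p] by simp
    then have "maximalideal P A" unfolding p(2) by (rule irreducible_imp_maximalideal[OF p(1)])
    then have "(THE m. maximalideal m A) = P"
      using assms(1) unfolding mixedchar_dp_minimal_DVR_def DVR_def by (metis the1_equality)
    then have "finite (a_rcosets\<^bsub>A\<^esub> P)"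
      using assms(1) unfolding mixedchar_dp_minimal_DVR_def residue_field_def FactRing_def by simp
    then show "finite_index P" using finite_index_iff[OF ideal.axioms(1)[OF idl]] by simp
  qed
qed

locale finite_index_embedding = R: "domain" R for R :: "('a, 'm) ring_scheme" +
  fixes A :: "('b, 'n) ring_scheme" and h :: "'a \<Rightarrow> 'b"
  assumes A: "mixedchar_dp_minimal_DVR A"
    and hom: "h \<in> ring_hom R A" and inj: "inj_on h (carrier R)"
    and fin: "finite_index_subring (h ` carrier R) A"
begin

sublocale A: principal_domain A
  using A unfolding mixedchar_dp_minimal_DVR_def DVR_def by simp

sublocale h: ring_hom_ring R A h
  by (intro ring_hom_ringI2 R.ring_axioms A.ring_axioms hom)

lemma subring: "subring (h ` carrier R) A"
  using fin unfolding finite_index_subring_def by simp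

lemma additive_subgroup: "additive_subgroup (h ` carrier R) A"
  using subring by (intro additive_subgroup.intro) (rule subring.axioms(1))

text \<open>Finitely many translates of the image cover \<open>A\<close>, which is infinite by
  dp-minimality.\<close>

lemma infinite_image: "infinite (h ` carrier R)"
proof
  assume fin_image: "finite (h ` carrier R)"
  have "A.finite_index (h ` carrier R)"
    using fin A.finite_index_iff[OF additive_subgroup] unfolding finite_index_subring_def by simp
  then obtain G where G: "finite G" "G \<subseteq> carrier A" "\<forall>x\<in>carrier A. \<exists>g\<in>G. x \<ominus>\<^bsub>A\<^esub> g \<in> h ` carrier R"
    unfolding A.finite_index_def by (elim exE conjE)
  have "carrier A \<subseteq> (\<lambda>(s, g). s \<oplus>\<^bsub>A\<^esub> g) ` (h ` carrier R \<times> G)"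
  proof
    fix x assume x: "x \<in> carrier A"
    obtain g where g: "g \<in> G" "x \<ominus>\<^bsub>A\<^esub> g \<in> h ` carrier R" using bspec[OF G(3) x] by (elim bexE)
    have "x = (x \<ominus>\<^bsub>A\<^esub> g) \<oplus>\<^bsub>A\<^esub> g" using A.add_minus_cancel(3)[OF x subsetD[OF G(2) g(1)]] by simp
    then show "x \<in> (\<lambda>(s, g). s \<oplus>\<^bsub>A\<^esub> g) ` (h ` carrier R \<times> G)"
      using g by (intro image_eqI[of _ _ "(x \<ominus>\<^bsub>A\<^esub> g, g)"]) simp_all
  qed
  then have "finite (carrier A)" by (rule finite_subset) (use G(1) fin_image in simp)
  then show False using A unfolding mixedchar_dp_minimal_DVR_def dp_minimal_def by simp
qed

text \<open>The conductor of a subring \<open>S\<close> of finite index is nonzero: \<open>S\<close> is infinite and acts by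
  multiplication on the finite group \<open>A / S\<close>, so two elements of \<open>S\<close> act in the same way.\<close>

lemma conductor:
  obtains u where "u \<in> carrier A" "u \<noteq> \<zero>\<^bsub>A\<^esub>" "\<forall>y\<in>carrier A. u \<otimes>\<^bsub>A\<^esub> y \<in> h ` carrier R"
proof -
  let ?S = "h ` carrier R"
  have "A.finite_index ?S"
    using fin A.finite_index_iff[OF additive_subgroup] unfolding finite_index_subring_def by simp
  then obtain G where G: "finite G" "G \<subseteq> carrier A" "\<forall>x\<in>carrier A. \<exists>g\<in>G. x \<ominus>\<^bsub>A\<^esub> g \<in> ?S"
    unfolding A.finite_index_def by (elim exE conjE)
  note S = subringE[OF subring]
  \<comment> \<open>The action on the quotient group is recorded only on the representatives in
    \<open>G\<close>; these determine it because \<open>?S\<close> is closed under products.\<close>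
  define \<phi> where "\<phi> s = (\<lambda>g\<in>G. ?S +>\<^bsub>A\<^esub> (s \<otimes>\<^bsub>A\<^esub> g))" for s
  have "\<phi> ` ?S \<subseteq> G \<rightarrow>\<^sub>E a_rcosets\<^bsub>A\<^esub> ?S"
  proof (rule image_subsetI)
    fix s assume s: "s \<in> ?S"
    have "?S +>\<^bsub>A\<^esub> (s \<otimes>\<^bsub>A\<^esub> g) \<in> a_rcosets\<^bsub>A\<^esub> ?S" if "g \<in> G" for g
      using subsetD[OF S(1) s] subsetD[OF G(2) that] by (intro A.a_rcosetsI[OF S(1)]) simp
    then show "\<phi> s \<in> G \<rightarrow>\<^sub>E a_rcosets\<^bsub>A\<^esub> ?S" unfolding \<phi>_def by (intro restrict_PiE_iff[THEN iffD2] ballI)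
  qed
  moreover have "finite (G \<rightarrow>\<^sub>E a_rcosets\<^bsub>A\<^esub> ?S)"
    using G(1) fin unfolding finite_index_subring_def by (intro finite_PiE) simp_all
  ultimately have "finite (\<phi> ` ?S)" by (rule finite_subset)
  then have "\<not> inj_on \<phi> ?S" using infinite_image finite_imageD by metis
  then obtain s s' where s: "s \<in> ?S" "s' \<in> ?S" "\<phi> s = \<phi> s'" "s \<noteq> s'" unfolding inj_on_def by metis
  note sA = subsetD[OF S(1) s(1)] subsetD[OF S(1) s(2)]
  let ?u = "s \<ominus>\<^bsub>A\<^esub> s'"
  have uS: "?u \<in> ?S" unfolding A.minus_eq using S(5,7) s(1,2) by simp
  show ?thesis
  proof (rule that[OF _ _ ballI])
    show "?u \<in> carrier A" using sA by simp
    show "?u \<noteq> \<zero>\<^bsub>A\<^esub>" using sA s(4) by simp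
    fix y assume y: "y \<in> carrier A"
    \<comment> \<open>Writing \<open>y\<close> as \<open>g\<close> plus an element of
      \<open>?S\<close> splits \<open>?u\<close> times \<open>y\<close> into a product of two
      elements of \<open>?S\<close> and the difference of the actions of \<open>s\<close> and
      \<open>s'\<close> on \<open>g\<close>.\<close>
    obtain g where g: "g \<in> G" "y \<ominus>\<^bsub>A\<^esub> g \<in> ?S" using bspec[OF G(3) y] by (elim bexE)
    have gA: "g \<in> carrier A" using g(1) G(2) by (rule subsetD[rotated])
    have "?S +>\<^bsub>A\<^esub> (s \<otimes>\<^bsub>A\<^esub> g) = ?S +>\<^bsub>A\<^esub> (s' \<otimes>\<^bsub>A\<^esub> g)"
      using fun_cong[OF s(3), of g] g(1) unfolding \<phi>_def by simp
    then have "s \<otimes>\<^bsub>A\<^esub> g \<ominus>\<^bsub>A\<^esub> s' \<otimes>\<^bsub>A\<^esub> g \<in> ?S"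
      using A.rcos_eq_iff[OF additive_subgroup] sA gA by simp
    then have "?u \<otimes>\<^bsub>A\<^esub> (y \<ominus>\<^bsub>A\<^esub> g) \<oplus>\<^bsub>A\<^esub> (s \<otimes>\<^bsub>A\<^esub> g \<ominus>\<^bsub>A\<^esub> s' \<otimes>\<^bsub>A\<^esub> g) \<in> ?S"
      using S(6,7) uS g(2) by simp
    moreover have "?u \<otimes>\<^bsub>A\<^esub> (y \<ominus>\<^bsub>A\<^esub> g) \<oplus>\<^bsub>A\<^esub> (s \<otimes>\<^bsub>A\<^esub> g \<ominus>\<^bsub>A\<^esub> s' \<otimes>\<^bsub>A\<^esub> g) = ?u \<otimes>\<^bsub>A\<^esub> y"
      using sA gA y by algebra
    ultimately show "?u \<otimes>\<^bsub>A\<^esub> y \<in> ?S" by simp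
  qed
qed

lemma finite_index_PIdl:
  assumes "u \<in> carrier A" "u \<noteq> \<zero>\<^bsub>A\<^esub>"
  shows "A.finite_index (PIdl\<^bsub>A\<^esub> u)"
  using finite_index_ideal_mixedchar[OF A A.cgenideal_ideal[OF assms(1)]]
    A.cgenideal_self[OF assms(1)] assms(2) by auto

text \<open>The image is a finite union of cosets of a principal ideal contained in it. As
  \<open>h\<close> is multiplicative, the denominator of the interpretation is 1.\<close>

lemma dp_minimal: "dp_minimal R"
proof -
  obtain u where u: "u \<in> carrier A" "u \<noteq> \<zero>\<^bsub>A\<^esub>" "\<forall>y\<in>carrier A. u \<otimes>\<^bsub>A\<^esub> y \<in> h ` carrier R"
    using conductor by metis
  obtain q :: nat and s where s: "\<forall>i<q. s i \<in> carrier A"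
    "h ` carrier R = {x. \<exists>i<q. \<exists>y\<in>carrier A. x = u \<otimes>\<^bsub>A\<^esub> y \<oplus>\<^bsub>A\<^esub> s i}"
    by (rule A.finite_coset_union[OF additive_subgroup u(1,3) finite_index_PIdl[OF u(1,2)]])
      (rule that)
  interpret coset_interpretation R A h "\<one>\<^bsub>A\<^esub>" u s q
    by unfold_locales (use inj u s in simp_all)
  have "infinite (carrier R)" using infinite_image by auto
  then show ?thesis using dp_minimal_lift A unfolding mixedchar_dp_minimal_DVR_def by simp
qed

text \<open>For nonzero \<open>r\<close> in \<open>I\<close> and \<open>u\<close> in the conductor,
  the ideal of \<open>A\<close> generated by \<open>h r\<close> times \<open>u\<close> lies in the
  image of \<open>r R\<close> and has finite index, so \<open>r\<close> and finitely many further
  elements generate \<open>I\<close>.\<close>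

lemma noetherian_domain: "noetherian_domain R"
proof (intro noetherian_domain.intro R.noetherian_ringI R.domain_axioms)
  fix I assume I: "ideal I R"
  interpret I: ideal I R by fact
  show "\<exists>G\<subseteq>carrier R. finite G \<and> I = Idl\<^bsub>R\<^esub> G"
  proof (cases "I = {\<zero>\<^bsub>R\<^esub>}")
    case True
    then show ?thesis using R.genideal_zero by (intro exI[of _ "{\<zero>\<^bsub>R\<^esub>}"]) simp
  next
    case False
    then obtain r where r: "r \<in> I" "r \<noteq> \<zero>\<^bsub>R\<^esub>" using I.zero_closed by auto
    note rR = I.Icarr[OF r(1)]
    have hr: "h r \<in> carrier A" "h r \<noteq> \<zero>\<^bsub>A\<^esub>"
      using rR r(2) inj_onD[OF inj _ rR R.zero_closed] by auto
    obtain u where u: "u \<in> carrier A" "u \<noteq> \<zero>\<^bsub>A\<^esub>" "\<forall>y\<in>carrier A. u \<otimes>\<^bsub>A\<^esub> y \<in> h ` carrier R"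
      using conductor by metis
    have ru: "h r \<otimes>\<^bsub>A\<^esub> u \<in> carrier A" "h r \<otimes>\<^bsub>A\<^esub> u \<noteq> \<zero>\<^bsub>A\<^esub>" using hr u A.integral_iff by simp_all
    obtain F where F: "finite F" "\<forall>x\<in>carrier A. \<exists>f\<in>F. x \<ominus>\<^bsub>A\<^esub> f \<in> PIdl\<^bsub>A\<^esub> (h r \<otimes>\<^bsub>A\<^esub> u)" "F \<subseteq> carrier A"
      using finite_index_PIdl[OF ru] unfolding A.finite_index_def by (elim exE conjE)
    \<comment> \<open>Only representatives that are images of elements of \<open>I\<close> matter;
      injectivity of \<open>h\<close> leaves finitely many preimages.\<close>
    define G where "G = insert r {z \<in> I. h z \<in> F}"
    have "finite (h -` F \<inter> carrier R)" using finite_vimage_IntI[OF F(1) inj] .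
    moreover have "{z \<in> I. h z \<in> F} \<subseteq> h -` F \<inter> carrier R" using I.Icarr by auto
    ultimately have "finite G" unfolding G_def using finite_subset by (metis finite_insert)
    have GI: "G \<subseteq> I" unfolding G_def using r(1) by auto
    have GR: "G \<subseteq> carrier R" using GI I.a_subset by (rule subset_trans)
    interpret J: ideal "Idl\<^bsub>R\<^esub> G" R by (rule R.genideal_ideal[OF GR])
    note GJ = R.genideal_self[OF GR]
    have "z \<in> Idl\<^bsub>R\<^esub> G" if z: "z \<in> I" for z
    proof -
      note zR = I.Icarr[OF z]
      obtain f where f: "f \<in> F" "h z \<ominus>\<^bsub>A\<^esub> f \<in> PIdl\<^bsub>A\<^esub> (h r \<otimes>\<^bsub>A\<^esub> u)"
        using bspec[OF F(2) h.hom_closed[OF zR]] by (elim bexE)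
      have fA: "f \<in> carrier A" using f(1) F(3) by (rule subsetD[rotated])
      obtain a where a: "a \<in> carrier A" "h z \<ominus>\<^bsub>A\<^esub> f = a \<otimes>\<^bsub>A\<^esub> (h r \<otimes>\<^bsub>A\<^esub> u)"
        using f(2) unfolding cgenideal_def by auto
      obtain b where b: "b \<in> carrier R" "u \<otimes>\<^bsub>A\<^esub> a = h b" using bspec[OF u(3) a(1)] by auto
      \<comment> \<open>Hence the representative \<open>f\<close> is the image of
        \<open>z - r b\<close>, which is one of the chosen generators.\<close>
      have "h z \<ominus>\<^bsub>A\<^esub> f = h r \<otimes>\<^bsub>A\<^esub> h b"
        unfolding a(2) b(2)[symmetric] using a(1) hr u(1) by (simp add: A.m_ac)
      moreover have "h z \<ominus>\<^bsub>A\<^esub> (h z \<ominus>\<^bsub>A\<^esub> f) = f" using h.hom_closed[OF zR] fA by algebra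
      moreover have "h (z \<ominus>\<^bsub>R\<^esub> r \<otimes>\<^bsub>R\<^esub> b) = h z \<ominus>\<^bsub>A\<^esub> h r \<otimes>\<^bsub>A\<^esub> h b"
        using zR rR b(1) by (simp add: R.minus_eq A.minus_eq)
      ultimately have "h (z \<ominus>\<^bsub>R\<^esub> r \<otimes>\<^bsub>R\<^esub> b) \<in> F" using f(1) by simp
      moreover have "z \<ominus>\<^bsub>R\<^esub> r \<otimes>\<^bsub>R\<^esub> b \<in> I"
        unfolding R.minus_eq using I.a_closed[OF z I.a_inv_closed[OF I.I_r_closed[OF r(1) b(1)]]] .
      ultimately have "z \<ominus>\<^bsub>R\<^esub> r \<otimes>\<^bsub>R\<^esub> b \<in> Idl\<^bsub>R\<^esub> G" using GJ unfolding G_def by auto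
      moreover have "r \<otimes>\<^bsub>R\<^esub> b \<in> Idl\<^bsub>R\<^esub> G"
        using GJ by (intro J.I_r_closed[OF _ b(1)]) (simp add: G_def)
      ultimately have "(z \<ominus>\<^bsub>R\<^esub> r \<otimes>\<^bsub>R\<^esub> b) \<oplus>\<^bsub>R\<^esub> r \<otimes>\<^bsub>R\<^esub> b \<in> Idl\<^bsub>R\<^esub> G" by (rule J.a_closed)
      then show ?thesis using R.add_minus_cancel(3)[OF zR R.m_closed[OF rR b(1)]] by simp
    qed
    then have "I \<subseteq> Idl\<^bsub>R\<^esub> G" by (rule subsetI)
    then have "I = Idl\<^bsub>R\<^esub> G" using R.genideal_minimal[OF I GI] by (rule subset_antisym)
    then show ?thesis using GR \<open>finite G\<close> by (intro exI[of _ G] conjI)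
  qed
qed

end

section \<open>Fields and the classification\<close>

lemma (in field) noetherian_domain: "noetherian_domain R"
proof (intro noetherian_domain.intro noetherian_ringI domain_axioms)
  fix I assume "ideal I R"
  then have "I = {\<zero>} \<or> I = carrier R" using all_ideals by auto
  then show "\<exists>G\<subseteq>carrier R. finite G \<and> I = Idl G"
  proof
    assume "I = {\<zero>}"
    then show ?thesis using genideal_zero by (intro exI[of _ "{\<zero>}"]) simp
  next
    assume "I = carrier R"
    then show ?thesis using genideal_one by (intro exI[of _ "{\<one>}"]) simp
  qed
qed

text \<open>Subrings are taken up to isomorphism, through the embedding \<open>h\<close>. An
  overring on the type of \<open>R\<close> suffices because the complete integral closure is
  realised on a subset of the carrier.\<close>

theorem theorem8p8:
  fixes R :: "'a ring"
  assumes "domain R"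
  shows "(noetherian_domain R \<and> dp_minimal R) \<longleftrightarrow>
           ((field R \<and> dp_minimal R) \<or>
            equichar_dp_minimal_DVR R \<or>
            (\<exists>(A :: 'a ring) h. mixedchar_dp_minimal_DVR A \<and>
                h \<in> ring_hom R A \<and> inj_on h (carrier R) \<and>
                finite_index_subring (h ` carrier R) A))"
    (is "?lhs \<longleftrightarrow> ?field \<or> ?equi \<or> ?mixed")
proof
  assume ?lhs
  then show "?field \<or> ?equi \<or> ?mixed" using noetherian_dp_minimal_cases[of R] by metis
next
  assume "?field \<or> ?equi \<or> ?mixed"
  then show ?lhs
  proof (elim disjE)
    assume ?field
    then show ?lhs by (intro conjI field.noetherian_domain) simp_all
  next
    assume *: ?equi
    then interpret principal_domain R unfolding equichar_dp_minimal_DVR_def DVR_def by simp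
    show ?lhs using * noetherian_domain_axioms unfolding equichar_dp_minimal_DVR_def by simp
  next
    assume ?mixed
    then obtain A :: "'a ring" and h where *: "mixedchar_dp_minimal_DVR A" "h \<in> ring_hom R A"
      "inj_on h (carrier R)" "finite_index_subring (h ` carrier R) A" by (elim exE conjE)
    interpret finite_index_embedding R A h
      by (intro finite_index_embedding.intro finite_index_embedding_axioms.intro assms *)
    show ?lhs using noetherian_domain dp_minimal by simp
  qed
qed

end
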